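(* Let $\mathcal C$ be an additive monoidal category with unit object $I$. Suppose that $I$ is a regular generator and that the endofunctors $-\otimes X$ and $X\otimes -$ preserve colimits in $\mathcal C$ for any object $X$ of $\mathcal C$. Let $L$ be an object of $\mathcal C$. If $(-\otimes L,\boldsymbol\lambda,\boldsymbol\Lambda)$ is a Lie monad on $\mathcal C$, then $(L,\boldsymbol\lambda_I,\boldsymbol\Lambda_I)$ is a YB-Lie algebra in $\mathcal C$. Moreover, there is a bijective correspondence between YB-Lie algebra structures on $L$ and Lie monad structures on the endofunctor $-\otimes L$.
   Context: Conventions: the tensor product is additive in each variable; associativity and unit constraints are suppressed (so $I\otimes L$ is identified with $L$); an object also denotes its identity morphism. For $c:L\otimes L\to L\otimes L$ put $t_c=(c\otimes L)\circ(L\otimes c)$ and $w_c=(L\otimes c)\circ(c\otimes L)$. A symmetric Yang-Baxter operator on $L$ is a morphism $c:L\otimes L\to L\otimes L$ with $c\circ c=1$ and $(c\otimes L)(L\otimes c)(c\otimes L)=(L\otimes c)(c\otimes L)(L\otimes c)$. A YB-Lie algebra in $\mathcal C$ is a triple $(L,\lambda,\Lambda)$ with $\lambda$ a symmetric Yang-Baxter operator on $L$ and $\Lambda:L\otimes L\to L$ a morphism such that $\Lambda\circ(1+\lambda)=0$, $\Lambda\circ(L\otimes\Lambda)\circ(1+t_\lambda+w_\lambda)=0$, and $\lambda\circ(\Lambda\otimes L)=(L\otimes\Lambda)\circ t_\lambda$. A Lie monad on an additive category $\mathcal C$ is a triple $(\mathbf L,\boldsymbol\lambda,\boldsymbol\Lambda)$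 with $\mathbf L:\mathcal C\to\mathcal C$ an additive functor, and natural transformations $\boldsymbol\lambda:\mathbf L\mathbf L\to\mathbf L\mathbf L$, $\boldsymbol\Lambda:\mathbf L\mathbf L\to\mathbf L$ such that, writing $(\boldsymbol\lambda\mathbf L)_X=\boldsymbol\lambda_{\mathbf LX}$, $(\mathbf L\boldsymbol\lambda)_X=\mathbf L(\boldsymbol\lambda_X)$ (similarly for $\boldsymbol\Lambda$), $t=(\mathbf L\boldsymbol\lambda)\circ(\boldsymbol\lambda\mathbf L)$ and $w=(\boldsymbol\lambda\mathbf L)\circ(\mathbf L\boldsymbol\lambda)$: $\boldsymbol\lambda\circ\boldsymbol\lambda=1$; $(\mathbf L\boldsymbol\lambda)(\boldsymbol\lambda\mathbf L)(\mathbf L\boldsymbol\lambda)=(\boldsymbol\lambda\mathbf L)(\mathbf L\boldsymbol\lambda)(\boldsymbol\lambda\mathbf L)$; $\boldsymbol\Lambda\circ(1+\boldsymbol\lambda)=0$; $\boldsymbol\Lambda\circ(\boldsymbol\Lambda\mathbf L)\circ(1+t+w)=0$; $\boldsymbol\lambda\circ(\mathbf L\boldsymbol\Lambda)=(\boldsymbol\Lambda\mathbf L)\circ t$. An object $G$ (in a category having the coproducts below) is a regular generator if for every object $X$ the fork $$\coprod_{(g,h)} G\rightrightarrows H=\coprod_{f:G\to X}G\xrightarrow{\ f_X\ }X$$ is a coequalizer; here $f_X$ is the canonical morphism with component $f$ at the index $f$, the first coproduct runs over all pairs $g,h:G\to H$ with $f_X\circ g=f_X\circ h$, and the two parallel arrows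 have components $g$ and $h$ respectively. *)

theory Defs
  imports "HOL-Algebra.Group" "HOL-Library.FuncSet" "HOL-Library.Equipollence"
begin

section \<open>Categories, functors and natural transformations\<close>

record ('o, 'a) cat =
  Obj :: "'o set"
  Arr :: "'a set"
  Dom :: "'a \<Rightarrow> 'o"
  Cod :: "'a \<Rightarrow> 'o"
  Id :: "'o \<Rightarrow> 'a"
  Comp :: "'a \<Rightarrow> 'a \<Rightarrow> 'a"  (infixl "\<cdot>\<index>" 70)

definition Hom :: "('o, 'a, 'm) cat_scheme \<Rightarrow> 'o \<Rightarrow> 'o \<Rightarrow> 'a set" where
  "Hom C X Y = {f \<in> Arr C. Dom C f = X \<and> Cod C f = Y}"

locale category =
  fixes C (structure)
  assumes Dom_closed: "f \<in> Arr C \<Longrightarrow> Dom C f \<in> Obj C"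
    and Cod_closed: "f \<in> Arr C \<Longrightarrow> Cod C f \<in> Obj C"
    and Id_closed: "X \<in> Obj C \<Longrightarrow> Id C X \<in> Hom C X X"
    and Comp_closed: "\<lbrakk>f \<in> Hom C X Y; g \<in> Hom C Y Z\<rbrakk> \<Longrightarrow> g \<cdot> f \<in> Hom C X Z"
    and Comp_assoc: "\<lbrakk>f \<in> Hom C X Y; g \<in> Hom C Y Z; h \<in> Hom C Z W\<rbrakk>
          \<Longrightarrow> (h \<cdot> g) \<cdot> f = h \<cdot> (g \<cdot> f)"
    and Id_left: "f \<in> Hom C X Y \<Longrightarrow> Id C Y \<cdot> f = f"
    and Id_right: "f \<in> Hom C X Y \<Longrightarrow> f \<cdot> Id C X = f"

definition inverse_arrows :: "('o, 'a, 'm) cat_scheme \<Rightarrow> 'a \<Rightarrow> 'a \<Rightarrow> bool" where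
  "inverse_arrows C f g \<longleftrightarrow> f \<in> Arr C \<and> g \<in> Hom C (Cod C f) (Dom C f)
     \<and> g \<cdot>\<^bsub>C\<^esub> f = Id C (Dom C f) \<and> f \<cdot>\<^bsub>C\<^esub> g = Id C (Cod C f)"

definition iso_arr :: "('o, 'a, 'm) cat_scheme \<Rightarrow> 'a \<Rightarrow> bool" where
  "iso_arr C f \<longleftrightarrow> (\<exists>g. inverse_arrows C f g)"

definition inv_arr :: "('o, 'a, 'm) cat_scheme \<Rightarrow> 'a \<Rightarrow> 'a" where
  "inv_arr C f = (THE g. inverse_arrows C f g)"

record ('p, 'b, 'o, 'a) func =
  fobj :: "'p \<Rightarrow> 'o"
  farr :: "'b \<Rightarrow> 'a"

definition is_functor ::
  "('p, 'b, 'm) cat_scheme \<Rightarrow> ('o, 'a, 'n) cat_scheme \<Rightarrow> ('p, 'b, 'o, 'a) func \<Rightarrow> bool" where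
  "is_functor A B F \<longleftrightarrow> category A \<and> category B
     \<and> (\<forall>X\<in>Obj A. fobj F X \<in> Obj B)
     \<and> (\<forall>X\<in>Obj A. \<forall>Y\<in>Obj A. \<forall>f\<in>Hom A X Y. farr F f \<in> Hom B (fobj F X) (fobj F Y))
     \<and> (\<forall>X\<in>Obj A. farr F (Id A X) = Id B (fobj F X))
     \<and> (\<forall>X\<in>Obj A. \<forall>Y\<in>Obj A. \<forall>Z\<in>Obj A. \<forall>f\<in>Hom A X Y. \<forall>g\<in>Hom A Y Z.
          farr F (g \<cdot>\<^bsub>A\<^esub> f) = farr F g \<cdot>\<^bsub>B\<^esub> farr F f)"

definition func_comp ::
  "('p, 'b, 'o, 'a) func \<Rightarrow> ('q, 'c, 'p, 'b) func \<Rightarrow> ('q, 'c, 'o, 'a) func"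
  (infixl "\<circ>\<^sub>F" 70) where
  "G \<circ>\<^sub>F F = \<lparr>fobj = (\<lambda>X. fobj G (fobj F X)), farr = (\<lambda>f. farr G (farr F f))\<rparr>"

text \<open>A family of components is a HOL function on the whole object type. It is required to be
  \<^const>\<open>undefined\<close> off the objects of the domain category, so that equality of natural
  transformations is equality of their components.\<close>

definition nat_trans ::
  "('p, 'b, 'm) cat_scheme \<Rightarrow> ('o, 'a, 'n) cat_scheme \<Rightarrow> ('p, 'b, 'o, 'a) func
     \<Rightarrow> ('p, 'b, 'o, 'a) func \<Rightarrow> ('p \<Rightarrow> 'a) \<Rightarrow> bool" where
  "nat_trans A B F G \<tau> \<longleftrightarrow> is_functor A B F \<and> is_functor A B G
     \<and> \<tau> \<in> extensional (Obj A)
     \<and> (\<forall>X\<in>Obj A. \<tau> X \<in> Hom B (fobj F X) (fobj G X))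
     \<and> (\<forall>X\<in>Obj A. \<forall>Y\<in>Obj A. \<forall>f\<in>Hom A X Y.
          \<tau> Y \<cdot>\<^bsub>B\<^esub> farr F f = farr G f \<cdot>\<^bsub>B\<^esub> \<tau> X)"

section \<open>Colimits\<close>

definition cocone ::
  "('p, 'b, 'm) cat_scheme \<Rightarrow> ('o, 'a, 'n) cat_scheme \<Rightarrow> ('p, 'b, 'o, 'a) func
     \<Rightarrow> 'o \<Rightarrow> ('p \<Rightarrow> 'a) \<Rightarrow> bool" where
  "cocone J C D X \<phi> \<longleftrightarrow> is_functor J C D \<and> X \<in> Obj C
     \<and> (\<forall>j\<in>Obj J. \<phi> j \<in> Hom C (fobj D j) X)
     \<and> (\<forall>u\<in>Arr J. \<phi> (Cod J u) \<cdot>\<^bsub>C\<^esub> farr D u = \<phi> (Dom J u))"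

definition is_colimit ::
  "('p, 'b, 'm) cat_scheme \<Rightarrow> ('o, 'a, 'n) cat_scheme \<Rightarrow> ('p, 'b, 'o, 'a) func
     \<Rightarrow> 'o \<Rightarrow> ('p \<Rightarrow> 'a) \<Rightarrow> bool" where
  "is_colimit J C D X \<phi> \<longleftrightarrow> cocone J C D X \<phi>
     \<and> (\<forall>Y \<psi>. cocone J C D Y \<psi> \<longrightarrow>
          (\<exists>!h. h \<in> Hom C X Y \<and> (\<forall>j\<in>Obj J. h \<cdot>\<^bsub>C\<^esub> \<phi> j = \<psi> j)))"

text \<open>HOL cannot quantify over all index categories inside a formula, so smallness is relative to
  a type \<open>'j\<close>: the small categories are those whose objects and arrows are drawn from \<open>'j\<close>.
  This is meaningful for an infinite \<open>'j\<close> into which every hom-set of the category embeds.\<close>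

definition locally_small :: "'j itself \<Rightarrow> ('o, 'a, 'm) cat_scheme \<Rightarrow> bool" where
  "locally_small T C \<longleftrightarrow> (\<forall>X\<in>Obj C. \<forall>Y\<in>Obj C. Hom C X Y \<lesssim> (UNIV :: 'j set))"

definition preserves_colimits ::
  "'j itself \<Rightarrow> ('p, 'b, 'm) cat_scheme \<Rightarrow> ('o, 'a, 'n) cat_scheme
     \<Rightarrow> ('p, 'b, 'o, 'a) func \<Rightarrow> bool" where
  "preserves_colimits T A B F \<longleftrightarrow>
     (\<forall>(J :: ('j, 'j) cat) D X \<phi>.
        is_colimit J A D X \<phi> \<longrightarrow>
        is_colimit J B (F \<circ>\<^sub>F D) (fobj F X) (\<lambda>j. farr F (\<phi> j)))"

definition is_coproduct ::
  "('o, 'a, 'm) cat_scheme \<Rightarrow> 'i set \<Rightarrow> ('i \<Rightarrow> 'o) \<Rightarrow> 'o \<Rightarrow> ('i \<Rightarrow> 'a) \<Rightarrow> bool" where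
  "is_coproduct C S A P \<iota> \<longleftrightarrow> (\<forall>i\<in>S. A i \<in> Obj C) \<and> P \<in> Obj C
     \<and> (\<forall>i\<in>S. \<iota> i \<in> Hom C (A i) P)
     \<and> (\<forall>Y\<in>Obj C. \<forall>f. (\<forall>i\<in>S. f i \<in> Hom C (A i) Y) \<longrightarrow>
          (\<exists>!h. h \<in> Hom C P Y \<and> (\<forall>i\<in>S. h \<cdot>\<^bsub>C\<^esub> \<iota> i = f i)))"

definition is_coequalizer ::
  "('o, 'a, 'm) cat_scheme \<Rightarrow> 'a \<Rightarrow> 'a \<Rightarrow> 'a \<Rightarrow> bool" where
  "is_coequalizer C p q e \<longleftrightarrow>
     (\<exists>K\<in>Obj C. \<exists>H\<in>Obj C. \<exists>X\<in>Obj C.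
        p \<in> Hom C K H \<and> q \<in> Hom C K H \<and> e \<in> Hom C H X \<and> e \<cdot>\<^bsub>C\<^esub> p = e \<cdot>\<^bsub>C\<^esub> q
        \<and> (\<forall>Y\<in>Obj C. \<forall>f\<in>Hom C H Y. f \<cdot>\<^bsub>C\<^esub> p = f \<cdot>\<^bsub>C\<^esub> q \<longrightarrow>
             (\<exists>!h. h \<in> Hom C X Y \<and> h \<cdot>\<^bsub>C\<^esub> e = f)))"

text \<open>The existence of the coproducts involved is part of the definition; as coproducts are unique
  up to isomorphism, the choice of \<open>H\<close> and \<open>K\<close> is immaterial.\<close>

definition regular_generator :: "('o, 'a, 'm) cat_scheme \<Rightarrow> 'o \<Rightarrow> bool" where
  "regular_generator C G \<longleftrightarrow> G \<in> Obj C \<and>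
     (\<forall>X\<in>Obj C. \<exists>H \<iota> f\<^sub>X K \<kappa> p q.
        is_coproduct C (Hom C G X) (\<lambda>_. G) H \<iota>
        \<and> f\<^sub>X \<in> Hom C H X \<and> (\<forall>f\<in>Hom C G X. f\<^sub>X \<cdot>\<^bsub>C\<^esub> \<iota> f = f)
        \<and> is_coproduct C {(g, h). g \<in> Hom C G H \<and> h \<in> Hom C G H \<and> f\<^sub>X \<cdot>\<^bsub>C\<^esub> g = f\<^sub>X \<cdot>\<^bsub>C\<^esub> h}
             (\<lambda>_. G) K \<kappa>
        \<and> p \<in> Hom C K H \<and> q \<in> Hom C K H
        \<and> (\<forall>g\<in>Hom C G H. \<forall>h\<in>Hom C G H. f\<^sub>X \<cdot>\<^bsub>C\<^esub> g = f\<^sub>X \<cdot>\<^bsub>C\<^esub> h \<longrightarrow>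
             p \<cdot>\<^bsub>C\<^esub> \<kappa> (g, h) = g \<and> q \<cdot>\<^bsub>C\<^esub> \<kappa> (g, h) = h)
        \<and> is_coequalizer C p q f\<^sub>X)"

section \<open>Additive categories\<close>

record ('o, 'a) ab_cat = "('o, 'a) cat" +
  Add :: "'a \<Rightarrow> 'a \<Rightarrow> 'a"  (infixl "\<boxplus>\<index>" 65)
  Zero :: "'o \<Rightarrow> 'o \<Rightarrow> 'a"

definition hom_group :: "('o, 'a, 'm) ab_cat_scheme \<Rightarrow> 'o \<Rightarrow> 'o \<Rightarrow> 'a monoid" where
  "hom_group C X Y = \<lparr>carrier = Hom C X Y, monoid.mult = Add C, one = Zero C X Y\<rparr>"

locale additive_category = category C for C (structure) +
  assumes hom_comm_group: "\<lbrakk>X \<in> Obj C; Y \<in> Obj C\<rbrakk> \<Longrightarrow> comm_group (hom_group C X Y)"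
    and Comp_add_left: "\<lbrakk>f \<in> Hom C X Y; g \<in> Hom C Y Z; g' \<in> Hom C Y Z\<rbrakk>
          \<Longrightarrow> (g \<boxplus> g') \<cdot> f = g \<cdot> f \<boxplus> g' \<cdot> f"
    and Comp_add_right: "\<lbrakk>f \<in> Hom C X Y; f' \<in> Hom C X Y; g \<in> Hom C Y Z\<rbrakk>
          \<Longrightarrow> g \<cdot> (f \<boxplus> f') = g \<cdot> f \<boxplus> g \<cdot> f'"
    and zero_object: "\<exists>Z\<in>Obj C. \<forall>X\<in>Obj C. (\<exists>!f. f \<in> Hom C Z X) \<and> (\<exists>!f. f \<in> Hom C X Z)"
    and biproducts: "\<lbrakk>X \<in> Obj C; Y \<in> Obj C\<rbrakk> \<Longrightarrow>
          \<exists>P\<in>Obj C. \<exists>i\<in>Hom C X P. \<exists>j\<in>Hom C Y P. \<exists>p\<in>Hom C P X. \<exists>q\<in>Hom C P Y.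
            p \<cdot> i = Id C X \<and> q \<cdot> j = Id C Y \<and> p \<cdot> j = Zero C Y X \<and> q \<cdot> i = Zero C X Y
            \<and> i \<cdot> p \<boxplus> j \<cdot> q = Id C P"

definition additive_functor ::
  "('p, 'b, 'm) ab_cat_scheme \<Rightarrow> ('o, 'a, 'n) ab_cat_scheme \<Rightarrow> ('p, 'b, 'o, 'a) func \<Rightarrow> bool" where
  "additive_functor A B F \<longleftrightarrow> is_functor A B F
     \<and> (\<forall>X\<in>Obj A. \<forall>Y\<in>Obj A. \<forall>f\<in>Hom A X Y. \<forall>g\<in>Hom A X Y.
          farr F (f \<boxplus>\<^bsub>A\<^esub> g) = farr F f \<boxplus>\<^bsub>B\<^esub> farr F g)"

section \<open>Additive monoidal categories\<close>

record ('o, 'a) mon_cat = "('o, 'a) ab_cat" +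
  TObj :: "'o \<Rightarrow> 'o \<Rightarrow> 'o"  (infixl "\<otimes>\<^sub>o\<index>" 75)
  TArr :: "'a \<Rightarrow> 'a \<Rightarrow> 'a"  (infixl "\<otimes>\<^sub>a\<index>" 75)
  Unit :: "'o"
  Assoc :: "'o \<Rightarrow> 'o \<Rightarrow> 'o \<Rightarrow> 'a"
  LUnit :: "'o \<Rightarrow> 'a"
  RUnit :: "'o \<Rightarrow> 'a"

text \<open>The monoidal structure is not assumed to be strict.\<close>

locale additive_monoidal_category = additive_category C for C (structure) +
  assumes TObj_closed: "\<lbrakk>X \<in> Obj C; Y \<in> Obj C\<rbrakk> \<Longrightarrow> X \<otimes>\<^sub>o Y \<in> Obj C"
    and TArr_closed: "\<lbrakk>f \<in> Hom C X X'; g \<in> Hom C Y Y'\<rbrakk>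
          \<Longrightarrow> f \<otimes>\<^sub>a g \<in> Hom C (X \<otimes>\<^sub>o Y) (X' \<otimes>\<^sub>o Y')"
    and TArr_Id: "\<lbrakk>X \<in> Obj C; Y \<in> Obj C\<rbrakk> \<Longrightarrow> Id C X \<otimes>\<^sub>a Id C Y = Id C (X \<otimes>\<^sub>o Y)"
    and TArr_Comp: "\<lbrakk>f \<in> Hom C X X'; f' \<in> Hom C X' X''; g \<in> Hom C Y Y'; g' \<in> Hom C Y' Y''\<rbrakk>
          \<Longrightarrow> (f' \<cdot> f) \<otimes>\<^sub>a (g' \<cdot> g) = (f' \<otimes>\<^sub>a g') \<cdot> (f \<otimes>\<^sub>a g)"
    and TArr_add_left: "\<lbrakk>f \<in> Hom C X X'; f' \<in> Hom C X X'; g \<in> Hom C Y Y'\<rbrakk>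
          \<Longrightarrow> (f \<boxplus> f') \<otimes>\<^sub>a g = f \<otimes>\<^sub>a g \<boxplus> f' \<otimes>\<^sub>a g"
    and TArr_add_right: "\<lbrakk>f \<in> Hom C X X'; g \<in> Hom C Y Y'; g' \<in> Hom C Y Y'\<rbrakk>
          \<Longrightarrow> f \<otimes>\<^sub>a (g \<boxplus> g') = f \<otimes>\<^sub>a g \<boxplus> f \<otimes>\<^sub>a g'"
    and Unit_closed: "Unit C \<in> Obj C"
    and Assoc_closed: "\<lbrakk>X \<in> Obj C; Y \<in> Obj C; Z \<in> Obj C\<rbrakk>
          \<Longrightarrow> Assoc C X Y Z \<in> Hom C ((X \<otimes>\<^sub>o Y) \<otimes>\<^sub>o Z) (X \<otimes>\<^sub>o (Y \<otimes>\<^sub>o Z))"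
    and Assoc_iso: "\<lbrakk>X \<in> Obj C; Y \<in> Obj C; Z \<in> Obj C\<rbrakk> \<Longrightarrow> iso_arr C (Assoc C X Y Z)"
    and Assoc_natural: "\<lbrakk>f \<in> Hom C X X'; g \<in> Hom C Y Y'; h \<in> Hom C Z Z'\<rbrakk>
          \<Longrightarrow> Assoc C X' Y' Z' \<cdot> ((f \<otimes>\<^sub>a g) \<otimes>\<^sub>a h) = (f \<otimes>\<^sub>a (g \<otimes>\<^sub>a h)) \<cdot> Assoc C X Y Z"
    and LUnit_closed: "X \<in> Obj C \<Longrightarrow> LUnit C X \<in> Hom C (Unit C \<otimes>\<^sub>o X) X"
    and LUnit_iso: "X \<in> Obj C \<Longrightarrow> iso_arr C (LUnit C X)"
    and LUnit_natural: "f \<in> Hom C X Y \<Longrightarrow> LUnit C Y \<cdot> (Id C (Unit C) \<otimes>\<^sub>a f) = f \<cdot> LUnit C X"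
    and RUnit_closed: "X \<in> Obj C \<Longrightarrow> RUnit C X \<in> Hom C (X \<otimes>\<^sub>o Unit C) X"
    and RUnit_iso: "X \<in> Obj C \<Longrightarrow> iso_arr C (RUnit C X)"
    and RUnit_natural: "f \<in> Hom C X Y \<Longrightarrow> RUnit C Y \<cdot> (f \<otimes>\<^sub>a Id C (Unit C)) = f \<cdot> RUnit C X"
    and pentagon: "\<lbrakk>X \<in> Obj C; Y \<in> Obj C; Z \<in> Obj C; W \<in> Obj C\<rbrakk> \<Longrightarrow>
          (Id C X \<otimes>\<^sub>a Assoc C Y Z W) \<cdot> Assoc C X (Y \<otimes>\<^sub>o Z) W \<cdot> (Assoc C X Y Z \<otimes>\<^sub>a Id C W)
          = Assoc C X Y (Z \<otimes>\<^sub>o W) \<cdot> Assoc C (X \<otimes>\<^sub>o Y) Z W"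
    and triangle: "\<lbrakk>X \<in> Obj C; Y \<in> Obj C\<rbrakk> \<Longrightarrow>
          (Id C X \<otimes>\<^sub>a LUnit C Y) \<cdot> Assoc C X (Unit C) Y = RUnit C X \<otimes>\<^sub>a Id C Y"

definition tensor_right :: "('o, 'a, 'm) mon_cat_scheme \<Rightarrow> 'o \<Rightarrow> ('o, 'a, 'o, 'a) func" where
  "tensor_right C X = \<lparr>fobj = (\<lambda>Y. Y \<otimes>\<^sub>o\<^bsub>C\<^esub> X), farr = (\<lambda>f. f \<otimes>\<^sub>a\<^bsub>C\<^esub> Id C X)\<rparr>"

definition tensor_left :: "('o, 'a, 'm) mon_cat_scheme \<Rightarrow> 'o \<Rightarrow> ('o, 'a, 'o, 'a) func" where
  "tensor_left C X = \<lparr>fobj = (\<lambda>Y. X \<otimes>\<^sub>o\<^bsub>C\<^esub> Y), farr = (\<lambda>f. Id C X \<otimes>\<^sub>a\<^bsub>C\<^esub> f)\<rparr>"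

section \<open>YB-Lie algebras\<close>

text \<open>All identities on the threefold tensor power of \<open>L\<close> are stated on \<open>(L \<otimes> L) \<otimes> L\<close>; the
  operator written \<open>L \<otimes> c\<close> when associativity is suppressed is there the conjugate of
  \<open>L \<otimes> c\<close> by the associator.\<close>

definition YB1 :: "('o, 'a, 'm) mon_cat_scheme \<Rightarrow> 'o \<Rightarrow> 'a \<Rightarrow> 'a" where
  "YB1 C L c = c \<otimes>\<^sub>a\<^bsub>C\<^esub> Id C L"

definition YB2 :: "('o, 'a, 'm) mon_cat_scheme \<Rightarrow> 'o \<Rightarrow> 'a \<Rightarrow> 'a" where
  "YB2 C L c = inv_arr C (Assoc C L L L) \<cdot>\<^bsub>C\<^esub> (Id C L \<otimes>\<^sub>a\<^bsub>C\<^esub> c) \<cdot>\<^bsub>C\<^esub> Assoc C L L L"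

definition t_op :: "('o, 'a, 'm) mon_cat_scheme \<Rightarrow> 'o \<Rightarrow> 'a \<Rightarrow> 'a" where
  "t_op C L c = YB1 C L c \<cdot>\<^bsub>C\<^esub> YB2 C L c"

definition w_op :: "('o, 'a, 'm) mon_cat_scheme \<Rightarrow> 'o \<Rightarrow> 'a \<Rightarrow> 'a" where
  "w_op C L c = YB2 C L c \<cdot>\<^bsub>C\<^esub> YB1 C L c"

definition symmetric_YB_operator :: "('o, 'a, 'm) mon_cat_scheme \<Rightarrow> 'o \<Rightarrow> 'a \<Rightarrow> bool" where
  "symmetric_YB_operator C L c \<longleftrightarrow>
     c \<in> Hom C (L \<otimes>\<^sub>o\<^bsub>C\<^esub> L) (L \<otimes>\<^sub>o\<^bsub>C\<^esub> L)
     \<and> c \<cdot>\<^bsub>C\<^esub> c = Id C (L \<otimes>\<^sub>o\<^bsub>C\<^esub> L)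
     \<and> YB1 C L c \<cdot>\<^bsub>C\<^esub> YB2 C L c \<cdot>\<^bsub>C\<^esub> YB1 C L c = YB2 C L c \<cdot>\<^bsub>C\<^esub> YB1 C L c \<cdot>\<^bsub>C\<^esub> YB2 C L c"

definition YB_Lie_algebra :: "('o, 'a, 'm) mon_cat_scheme \<Rightarrow> 'o \<Rightarrow> 'a \<Rightarrow> 'a \<Rightarrow> bool" where
  "YB_Lie_algebra C L c b \<longleftrightarrow>
     L \<in> Obj C
     \<and> symmetric_YB_operator C L c
     \<and> b \<in> Hom C (L \<otimes>\<^sub>o\<^bsub>C\<^esub> L) L
     \<and> b \<cdot>\<^bsub>C\<^esub> (Id C (L \<otimes>\<^sub>o\<^bsub>C\<^esub> L) \<boxplus>\<^bsub>C\<^esub> c) = Zero C (L \<otimes>\<^sub>o\<^bsub>C\<^esub> L) L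
     \<and> b \<cdot>\<^bsub>C\<^esub> (Id C L \<otimes>\<^sub>a\<^bsub>C\<^esub> b) \<cdot>\<^bsub>C\<^esub> Assoc C L L L
         \<cdot>\<^bsub>C\<^esub> (Id C (L \<otimes>\<^sub>o\<^bsub>C\<^esub> L \<otimes>\<^sub>o\<^bsub>C\<^esub> L) \<boxplus>\<^bsub>C\<^esub> t_op C L c \<boxplus>\<^bsub>C\<^esub> w_op C L c)
         = Zero C (L \<otimes>\<^sub>o\<^bsub>C\<^esub> L \<otimes>\<^sub>o\<^bsub>C\<^esub> L) L
     \<and> c \<cdot>\<^bsub>C\<^esub> (b \<otimes>\<^sub>a\<^bsub>C\<^esub> Id C L)
         = (Id C L \<otimes>\<^sub>a\<^bsub>C\<^esub> b) \<cdot>\<^bsub>C\<^esub> Assoc C L L L \<cdot>\<^bsub>C\<^esub> t_op C L c"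

section \<open>Lie monads\<close>

text \<open>The natural involution is called \<open>\<sigma>\<close>, its usual name being reserved for abstraction.\<close>

definition t_nat ::
  "('o, 'a, 'm) cat_scheme \<Rightarrow> ('o, 'a, 'o, 'a) func \<Rightarrow> ('o \<Rightarrow> 'a) \<Rightarrow> 'o \<Rightarrow> 'a" where
  "t_nat C F \<sigma> X = farr F (\<sigma> X) \<cdot>\<^bsub>C\<^esub> \<sigma> (fobj F X)"

definition w_nat ::
  "('o, 'a, 'm) cat_scheme \<Rightarrow> ('o, 'a, 'o, 'a) func \<Rightarrow> ('o \<Rightarrow> 'a) \<Rightarrow> 'o \<Rightarrow> 'a" where
  "w_nat C F \<sigma> X = \<sigma> (fobj F X) \<cdot>\<^bsub>C\<^esub> farr F (\<sigma> X)"

definition Lie_monad ::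
  "('o, 'a, 'm) ab_cat_scheme \<Rightarrow> ('o, 'a, 'o, 'a) func \<Rightarrow> ('o \<Rightarrow> 'a) \<Rightarrow> ('o \<Rightarrow> 'a) \<Rightarrow> bool" where
  "Lie_monad C F \<sigma> \<Lambda> \<longleftrightarrow>
     additive_category C
     \<and> additive_functor C C F
     \<and> nat_trans C C (F \<circ>\<^sub>F F) (F \<circ>\<^sub>F F) \<sigma>
     \<and> nat_trans C C (F \<circ>\<^sub>F F) F \<Lambda>
     \<and> (\<forall>X\<in>Obj C.
          let F1 = fobj F X; F2 = fobj F F1; F3 = fobj F F2 in
          \<sigma> X \<cdot>\<^bsub>C\<^esub> \<sigma> X = Id C F2
          \<and> farr F (\<sigma> X) \<cdot>\<^bsub>C\<^esub> \<sigma> F1 \<cdot>\<^bsub>C\<^esub> farr F (\<sigma> X)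
              = \<sigma> F1 \<cdot>\<^bsub>C\<^esub> farr F (\<sigma> X) \<cdot>\<^bsub>C\<^esub> \<sigma> F1
          \<and> \<Lambda> X \<cdot>\<^bsub>C\<^esub> (Id C F2 \<boxplus>\<^bsub>C\<^esub> \<sigma> X) = Zero C F2 F1
          \<and> \<Lambda> X \<cdot>\<^bsub>C\<^esub> \<Lambda> F1 \<cdot>\<^bsub>C\<^esub> (Id C F3 \<boxplus>\<^bsub>C\<^esub> t_nat C F \<sigma> X \<boxplus>\<^bsub>C\<^esub> w_nat C F \<sigma> X)
              = Zero C F3 F1
          \<and> \<sigma> X \<cdot>\<^bsub>C\<^esub> farr F (\<Lambda> X) = \<Lambda> F1 \<cdot>\<^bsub>C\<^esub> t_nat C F \<sigma> X)"

text \<open>The components at \<open>I\<close> live on \<open>(I \<otimes> L) \<otimes> L\<close> and \<open>I \<otimes> L\<close>; the following are these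
  components after identifying \<open>I \<otimes> L\<close> with \<open>L\<close> along the left unit constraint.\<close>

definition braiding_at_unit :: "('o, 'a, 'm) mon_cat_scheme \<Rightarrow> 'o \<Rightarrow> ('o \<Rightarrow> 'a) \<Rightarrow> 'a" where
  "braiding_at_unit C L \<sigma> = (let u = LUnit C L \<otimes>\<^sub>a\<^bsub>C\<^esub> Id C L in
     u \<cdot>\<^bsub>C\<^esub> \<sigma> (Unit C) \<cdot>\<^bsub>C\<^esub> inv_arr C u)"

definition bracket_at_unit :: "('o, 'a, 'm) mon_cat_scheme \<Rightarrow> 'o \<Rightarrow> ('o \<Rightarrow> 'a) \<Rightarrow> 'a" where
  "bracket_at_unit C L \<Lambda> = (let u = LUnit C L \<otimes>\<^sub>a\<^bsub>C\<^esub> Id C L in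
     LUnit C L \<cdot>\<^bsub>C\<^esub> \<Lambda> (Unit C) \<cdot>\<^bsub>C\<^esub> inv_arr C u)"

end

theory Submission
  imports Defs
begin

text \<open>Arrows \<open>I \<rightarrow> X\<close> into a fixed \<open>X\<close> are jointly epic because \<open>I\<close> is a regular generator, and they stay
  so after applying \<open>- \<otimes> L\<close>, which preserves colimits. Hence a natural transformation between
  powers of \<open>- \<otimes> L\<close> is determined by its component at \<open>I\<close>, so the transformations
  \<open>\<sigma>\<close> and \<open>\<Lambda>\<close> are, up to associators, \<open>- \<otimes> c\<close> and \<open>- \<otimes> b\<close> for unique \<open>c\<close> and \<open>b\<close>. Under
  these identifications each Lie monad axiom at \<open>X\<close> is \<open>X \<otimes> -\<close> applied to the corresponding
  YB-Lie axiom, and at \<open>X = I\<close> nothing is lost, since \<open>I \<otimes> -\<close> is faithful.\<close>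

section \<open>Arrows and isomorphisms\<close>

context category
begin

lemma HomI [intro]: "\<lbrakk>f \<in> Arr C; Dom C f = X; Cod C f = Y\<rbrakk> \<Longrightarrow> f \<in> Hom C X Y"
  by (simp add: Hom_def)

lemma Hom_self: "f \<in> Arr C \<Longrightarrow> f \<in> Hom C (Dom C f) (Cod C f)"
  by (simp add: Hom_def)

lemma HomD:
  assumes "f \<in> Hom C X Y"
  shows "f \<in> Arr C" "Dom C f = X" "Cod C f = Y"
  using assms by (simp_all add: Hom_def)

lemma HomE: "\<lbrakk>f \<in> Hom C X Y; \<lbrakk>f \<in> Arr C; Dom C f = X; Cod C f = Y\<rbrakk> \<Longrightarrow> P\<rbrakk> \<Longrightarrow> P"
  by (simp add: Hom_def)

declare Dom_closed [simp] Cod_closed [simp]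

text \<open>The locale axioms speak of membership in hom-sets. Rephrased with \<open>Arr\<close>,
  \<open>Dom\<close> and \<open>Cod\<close> they become conditional rewrite rules whose side
  conditions the simplifier can compute.\<close>

lemma Id_simps [simp]:
  assumes "X \<in> Obj C"
  shows "Id C X \<in> Arr C" "Dom C (Id C X) = X" "Cod C (Id C X) = X"
  using Id_closed[OF assms] by (auto simp: Hom_def)

lemma Comp_simps [simp]:
  assumes "f \<in> Arr C" "g \<in> Arr C" "Dom C g = Cod C f"
  shows "g \<cdot> f \<in> Arr C" "Dom C (g \<cdot> f) = Dom C f" "Cod C (g \<cdot> f) = Cod C g"
  using Comp_closed[of f "Dom C f" "Cod C f" g "Cod C g"] assms by (auto simp: Hom_def)

lemma Comp_assoc_Arr:
  "\<lbrakk>f \<in> Arr C; g \<in> Arr C; h \<in> Arr C; Dom C g = Cod C f; Dom C h = Cod C g\<rbrakk>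
    \<Longrightarrow> (h \<cdot> g) \<cdot> f = h \<cdot> (g \<cdot> f)"
  by (rule Comp_assoc) (auto simp: Hom_def)

lemma Id_Comp [simp]: "\<lbrakk>f \<in> Arr C; Cod C f = X\<rbrakk> \<Longrightarrow> Id C X \<cdot> f = f"
  by (rule Id_left) (auto simp: Hom_def)

lemma Comp_Id [simp]: "\<lbrakk>f \<in> Arr C; Dom C f = X\<rbrakk> \<Longrightarrow> f \<cdot> Id C X = f"
  by (rule Id_right) (auto simp: Hom_def)

text \<open>Uniqueness gives meaning to the definite description behind
  \<open>inv_arr\<close>.\<close>

lemma inverse_arrows_unique:
  assumes "inverse_arrows C f g" "inverse_arrows C f h"
  shows "g = h"
proof -
  have "g = g \<cdot> (f \<cdot> h)"
    using assms by (auto simp: inverse_arrows_def Hom_def)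
  also have "\<dots> = (g \<cdot> f) \<cdot> h"
    using assms by (subst Comp_assoc_Arr) (auto simp: inverse_arrows_def Hom_def)
  also have "\<dots> = h"
    using assms by (auto simp: inverse_arrows_def Hom_def)
  finally show ?thesis .
qed

lemma inverse_arrows_inv_arr: "iso_arr C f \<Longrightarrow> inverse_arrows C f (inv_arr C f)"
  unfolding iso_arr_def inv_arr_def by (metis inverse_arrows_unique theI)

lemma iso_arr_simps [simp]:
  assumes "iso_arr C f"
  shows "f \<in> Arr C" "inv_arr C f \<in> Arr C"
    "Dom C (inv_arr C f) = Cod C f" "Cod C (inv_arr C f) = Dom C f"
    "inv_arr C f \<cdot> f = Id C (Dom C f)" "f \<cdot> inv_arr C f = Id C (Cod C f)"
  using inverse_arrows_inv_arr[OF assms] by (auto simp: inverse_arrows_def Hom_def)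

lemma iso_arrI:
  "\<lbrakk>f \<in> Arr C; g \<in> Arr C; Dom C g = Cod C f; Cod C g = Dom C f;
    g \<cdot> f = Id C (Dom C f); f \<cdot> g = Id C (Cod C f)\<rbrakk> \<Longrightarrow> iso_arr C f"
  unfolding iso_arr_def inverse_arrows_def Hom_def by auto

lemma inv_arr_Comp_cancel [simp]:
  "\<lbrakk>iso_arr C f; g \<in> Arr C; Cod C g = Dom C f\<rbrakk> \<Longrightarrow> inv_arr C f \<cdot> (f \<cdot> g) = g"
  by (subst Comp_assoc_Arr[symmetric]) auto

lemma Comp_inv_arr_cancel [simp]:
  "\<lbrakk>iso_arr C f; g \<in> Arr C; Cod C g = Cod C f\<rbrakk> \<Longrightarrow> f \<cdot> (inv_arr C f \<cdot> g) = g"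
  by (subst Comp_assoc_Arr[symmetric]) auto

lemma iso_cancel_left:
  "\<lbrakk>iso_arr C f; g \<in> Arr C; h \<in> Arr C; Cod C g = Dom C f; Cod C h = Dom C f; f \<cdot> g = f \<cdot> h\<rbrakk>
    \<Longrightarrow> g = h"
  by (metis inv_arr_Comp_cancel)

lemma iso_cancel_right:
  assumes "iso_arr C f" "g \<in> Arr C" "h \<in> Arr C" "Dom C g = Cod C f" "Dom C h = Cod C f"
    "g \<cdot> f = h \<cdot> f"
  shows "g = h"
proof -
  have "g = (g \<cdot> f) \<cdot> inv_arr C f" "h = (h \<cdot> f) \<cdot> inv_arr C f"
    using assms(1-5) by (simp_all add: Comp_assoc_Arr)
  with assms(6) show ?thesis by simp
qed

lemma iso_Id [simp]: "X \<in> Obj C \<Longrightarrow> iso_arr C (Id C X)"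
  by (rule iso_arrI[where g = "Id C X"]) auto

lemma iso_Comp [simp]:
  assumes "iso_arr C f" "iso_arr C g" "Dom C g = Cod C f"
  shows "iso_arr C (g \<cdot> f)"
  using assms by (intro iso_arrI[where g = "inv_arr C f \<cdot> inv_arr C g"]) (simp_all add: Comp_assoc_Arr)

end

section \<open>Jointly epic families\<close>

text \<open>The family is indexed and its sources may vary, so that a functor acts on it term by
  term and the index set can be moved to another type.\<close>

definition jointly_epic :: "('o, 'a, 'm) cat_scheme \<Rightarrow> 'i set \<Rightarrow> ('i \<Rightarrow> 'a) \<Rightarrow> 'o \<Rightarrow> bool" where
  "jointly_epic C S g X \<longleftrightarrow> X \<in> Obj C \<and> (\<forall>i\<in>S. g i \<in> Arr C \<and> Cod C (g i) = X)
     \<and> (\<forall>Y. \<forall>u\<in>Hom C X Y. \<forall>v\<in>Hom C X Y. (\<forall>i\<in>S. u \<cdot>\<^bsub>C\<^esub> g i = v \<cdot>\<^bsub>C\<^esub> g i) \<longrightarrow> u = v)"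

text \<open>Arrows out of X that agree on every arrow from G agree after composition with the
  canonical arrow from the coproduct, by uniqueness in its universal property; that canonical arrow
  is epic, being a coequalizer.\<close>

lemma (in category) regular_generator_jointly_epic:
  assumes "regular_generator C G" "X \<in> Obj C"
  shows "jointly_epic C (Hom C G X) (\<lambda>f. f) X"
proof -
  obtain H \<iota> e K p q where cop: "is_coproduct C (Hom C G X) (\<lambda>_. G) H \<iota>"
    and e: "e \<in> Hom C H X" "\<forall>f\<in>Hom C G X. e \<cdot> \<iota> f = f"
    and ceq: "is_coequalizer C p q e"
    using conjunct2[OF assms(1)[unfolded regular_generator_def], rule_format, OF assms(2)]
    by (elim exE conjE) (rule that)
  have "u = v" if u: "u \<in> Hom C X Y" and v: "v \<in> Hom C X Y"
    and eq: "\<forall>f\<in>Hom C G X. u \<cdot> f = v \<cdot> f" for Y u v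
  proof -
    have Y: "Y \<in> Obj C" using u by (auto simp: Hom_def)
    have \<iota>: "\<iota> f \<in> Hom C G H" if "f \<in> Hom C G X" for f
      using cop that unfolding is_coproduct_def by blast
    have c: "(w \<cdot> e) \<cdot> \<iota> f = w \<cdot> f" if "w \<in> Hom C X Y" "f \<in> Hom C G X" for w f
      using Comp_assoc[OF \<iota> e(1) that(1)] that e(2) by auto
    have ue: "u \<cdot> e \<in> Hom C H Y" and ve: "v \<cdot> e \<in> Hom C H Y"
      using u v e(1) Comp_closed by blast+
    have uf: "\<forall>f\<in>Hom C G X. u \<cdot> f \<in> Hom C G Y"
      using u Comp_closed by blast
    have "\<exists>!h. h \<in> Hom C H Y \<and> (\<forall>f\<in>Hom C G X. h \<cdot> \<iota> f = u \<cdot> f)"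
      using cop Y uf unfolding is_coproduct_def by simp
    then have uv: "u \<cdot> e = v \<cdot> e"
      using ue ve c[OF u] c[OF v] eq by metis
    obtain K' H' X' where k: "p \<in> Hom C K' H'" "q \<in> Hom C K' H'" "e \<in> Hom C H' X'"
      "e \<cdot> p = e \<cdot> q" and univ: "\<forall>Y\<in>Obj C. \<forall>f\<in>Hom C H' Y. f \<cdot> p = f \<cdot> q \<longrightarrow>
             (\<exists>!h. h \<in> Hom C X' Y \<and> h \<cdot> e = f)"
      using ceq unfolding is_coequalizer_def by blast
    have [simp]: "H' = H" "X' = X" using k(3) e(1) by (auto simp: Hom_def)
    have "(u \<cdot> e) \<cdot> p = (u \<cdot> e) \<cdot> q"
      using Comp_assoc[OF k(1) k(3)] Comp_assoc[OF k(2) k(3)] u k(4) by simp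
    \<comment> \<open>\<open>u\<close> and \<open>v\<close> are both factorizations of this one
      arrow through the coequalizer.\<close>
    with univ ue Y have "\<exists>!h. h \<in> Hom C X Y \<and> h \<cdot> e = u \<cdot> e" by simp
    with uv u v show ?thesis by metis
  qed
  then show ?thesis
    using assms(2) unfolding jointly_epic_def by (auto simp: Hom_def)
qed

text \<open>Joint epicness is a colimit statement: \<open>X\<close>, with two identities, is the colimit of the diagram
  made of two copies of \<open>g\<close> glued along the sources. The points \<open>a\<close> and \<open>b\<close> of the index type
  carry the two copies of \<open>X\<close>, and the arrows of the index category are pairs of points, coded in
  \<open>'j\<close> by a bijection.\<close>

lemma jointly_epic_image_aux:
  fixes S :: "'j set" and F :: "('o, 'a, 'p, 'b) func"
  assumes F: "is_functor A B F" and pres: "preserves_colimits TYPE('j) A B F"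
    and inf: "infinite (UNIV :: 'j set)"
    and epi: "jointly_epic A S g X"
    and ab: "a \<notin> S" "b \<notin> S" "a \<noteq> b"
  shows "jointly_epic B S (\<lambda>i. farr F (g i)) (fobj F X)"
proof -
  interpret A: category A using F by (simp add: is_functor_def)
  interpret B: category B using F by (simp add: is_functor_def)
  obtain c :: "'j \<times> 'j \<Rightarrow> 'j" where c: "bij c"
    using card_of_Times_same_infinite[OF inf] unfolding card_of_ordIso[symmetric] by auto
  define d where "d = inv_into UNIV c"
  have dc [simp]: "d (c z) = z" for z
    using c by (simp add: d_def bij_is_inj)
  have ceq [simp]: "c z = c w \<longleftrightarrow> z = w" for z w
    using dc by metis
  have X: "X \<in> Obj A" and g: "\<And>i. i \<in> S \<Longrightarrow> g i \<in> Arr A" "\<And>i. i \<in> S \<Longrightarrow> Cod A (g i) = X"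
    using epi by (auto simp: jointly_epic_def)
  define T where "T = S \<union> {a, b}"
  \<comment> \<open>Apart from identities there is one arrow from each point of \<open>S\<close> to
    each of \<open>a\<close> and \<open>b\<close>. No two of these compose, so keeping the outer
    endpoints is a lawful composition.\<close>
  define J :: "('j, 'j) cat" where "J = \<lparr>Obj = T,
    Arr = c ` {(x, y). x \<in> T \<and> y \<in> T \<and> (x = y \<or> x \<in> S \<and> y \<notin> S)},
    Dom = \<lambda>u. fst (d u), Cod = \<lambda>u. snd (d u), Id = \<lambda>x. c (x, x),
    Comp = \<lambda>v u. c (fst (d u), snd (d v))\<rparr>"
  define D where "D = \<lparr>fobj = \<lambda>x. if x \<in> S then Dom A (g x) else X,
     farr = \<lambda>u. if fst (d u) = snd (d u) then Id A (if fst (d u) \<in> S then Dom A (g (fst (d u))) else X)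
               else g (fst (d u))\<rparr>"
  define \<phi> where "\<phi> x = (if x \<in> S then g x else Id A X)" for x
  have J_simps [simp]: "Obj J = T" "\<And>x y. Dom J (c (x, y)) = x" "\<And>x y. Cod J (c (x, y)) = y"
    "\<And>x. Id J x = c (x, x)" "\<And>x y z w. Comp J (c (y, z)) (c (x, w)) = c (x, z)"
    "\<And>x y. c (x, y) \<in> Arr J \<longleftrightarrow> x \<in> T \<and> y \<in> T \<and> (x = y \<or> x \<in> S \<and> y \<notin> S)"
    by (auto simp: J_def)
  have D_simps [simp]: "\<And>x. x \<in> S \<Longrightarrow> fobj D x = Dom A (g x)" "\<And>x. x \<notin> S \<Longrightarrow> fobj D x = X"
    "\<And>x. farr D (c (x, x)) = Id A (fobj D x)"
    "\<And>x y. \<lbrakk>x \<in> S; y \<notin> S\<rbrakk> \<Longrightarrow> farr D (c (x, y)) = g x"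
    by (auto simp: D_def)
  have ArrE: thesis if "u \<in> Arr J"
    "\<And>x. \<lbrakk>u = c (x, x); x \<in> T\<rbrakk> \<Longrightarrow> thesis"
    "\<And>x y. \<lbrakk>u = c (x, y); x \<in> S; y \<in> T; y \<notin> S\<rbrakk> \<Longrightarrow> thesis" for u thesis
    using that by (auto simp: J_def)
  have D_obj [simp]: "fobj D x \<in> Obj A" for x
    using X g by (cases "x \<in> S") auto
  have S_T [simp]: "x \<in> S \<Longrightarrow> x \<in> T" for x
    by (simp add: T_def)
  have J: "category J"
    by unfold_locales (auto simp: Hom_def elim!: ArrE)
  have D: "is_functor J A D"
    unfolding is_functor_def
  proof (intro conjI ballI J A.category_axioms)
    fix x y u assume "u \<in> Hom J x y"
    then show "farr D u \<in> Hom A (fobj D x) (fobj D y)"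
      using g by (auto simp: Hom_def elim!: ArrE)
  next
    fix x y z u v assume "u \<in> Hom J x y" "v \<in> Hom J y z"
    then show "farr D (v \<cdot>\<^bsub>J\<^esub> u) = farr D v \<cdot>\<^bsub>A\<^esub> farr D u"
      using g by (auto simp: Hom_def elim!: ArrE)
  qed auto
  have "is_colimit J A D X \<phi>"
    unfolding is_colimit_def
  proof (intro conjI allI impI)
    show "cocone J A D X \<phi>"
      unfolding cocone_def using D X g by (auto simp: \<phi>_def Hom_def elim!: ArrE)
  next
    fix Y \<psi> assume "cocone J A D Y \<psi>"
    then have Y: "Y \<in> Obj A" and \<psi>: "\<And>x. x \<in> T \<Longrightarrow> \<psi> x \<in> Hom A (fobj D x) Y"
      and comp: "\<And>u. u \<in> Arr J \<Longrightarrow> \<psi> (Cod J u) \<cdot>\<^bsub>A\<^esub> farr D u = \<psi> (Dom J u)"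
      by (auto simp: cocone_def)
    have ha: "\<psi> a \<in> Hom A X Y" "\<psi> b \<in> Hom A X Y"
      using \<psi>[of a] \<psi>[of b] ab by (auto simp: T_def)
    have fa: "\<psi> a \<cdot>\<^bsub>A\<^esub> g i = \<psi> i" "\<psi> b \<cdot>\<^bsub>A\<^esub> g i = \<psi> i" if "i \<in> S" for i
    proof -
      have "i \<noteq> a" "i \<noteq> b" using that ab by auto
      then show "\<psi> a \<cdot>\<^bsub>A\<^esub> g i = \<psi> i" "\<psi> b \<cdot>\<^bsub>A\<^esub> g i = \<psi> i"
        using comp[of "c (i, a)"] comp[of "c (i, b)"] that ab
        by (auto simp: T_def)
    qed
    \<comment> \<open>The two legs on the copies of X both restrict to \<open>\<psi> i\<close> along
      \<open>g i\<close>, so the assumed joint epicness identifies them.\<close>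
    have ab_eq: "\<psi> a = \<psi> b"
      using epi ha fa unfolding jointly_epic_def by simp
    show "\<exists>!h. h \<in> Hom A X Y \<and> (\<forall>j\<in>Obj J. h \<cdot>\<^bsub>A\<^esub> \<phi> j = \<psi> j)"
    proof (rule ex1I[of _ "\<psi> a"])
      show "\<psi> a \<in> Hom A X Y \<and> (\<forall>j\<in>Obj J. \<psi> a \<cdot>\<^bsub>A\<^esub> \<phi> j = \<psi> j)"
        using ha fa ab_eq ab by (auto simp: T_def \<phi>_def Hom_def)
    next
      fix h assume h: "h \<in> Hom A X Y \<and> (\<forall>j\<in>Obj J. h \<cdot>\<^bsub>A\<^esub> \<phi> j = \<psi> j)"
      then have "h \<cdot>\<^bsub>A\<^esub> \<phi> a = \<psi> a" by (auto simp: T_def)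
      with h ab show "h = \<psi> a" by (auto simp: \<phi>_def Hom_def)
    qed
  qed
  then have col: "is_colimit J B (F \<circ>\<^sub>F D) (fobj F X) (\<lambda>j. farr F (\<phi> j))"
    using pres unfolding preserves_colimits_def by blast
  then have FD: "is_functor J B (F \<circ>\<^sub>F D)" by (auto simp: is_colimit_def cocone_def)
  have Fg: "farr F (g i) \<in> Hom B (fobj F (Dom A (g i))) (fobj F X)" if "i \<in> S" for i
    using F A.Dom_closed A.Cod_closed A.Hom_self g[OF that] unfolding is_functor_def by metis
  have FI: "farr F (Id A Y) = Id B (fobj F Y)" "fobj F Y \<in> Obj B" if "Y \<in> Obj A" for Y
    using F that unfolding is_functor_def by auto
  have "u = v" if uv: "u \<in> Hom B (fobj F X) Y" "v \<in> Hom B (fobj F X) Y"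
    and eq: "\<forall>i\<in>S. u \<cdot>\<^bsub>B\<^esub> farr F (g i) = v \<cdot>\<^bsub>B\<^esub> farr F (g i)" for Y u v
  proof -
    \<comment> \<open>The pair to be compared becomes a cocone with leg \<open>u\<close> at
      \<open>a\<close> and leg \<open>v\<close> at \<open>b\<close>. Since the colimit legs at both
      points are images of identities, the mediating arrow equals \<open>u\<close> as well as
      \<open>v\<close>.\<close>
    define \<psi> where "\<psi> x = (if x \<in> S then u \<cdot>\<^bsub>B\<^esub> farr F (g x) else if x = a then u else v)" for x
    have Y: "Y \<in> Obj B" using uv by (auto simp: Hom_def)
    have w: "w \<cdot>\<^bsub>B\<^esub> farr F (g i) \<in> Hom B (fobj F (Dom A (g i))) Y"
      if "i \<in> S" "w \<in> Hom B (fobj F X) Y" for i w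
      using Fg[OF that(1)] that(2) by (rule B.Comp_closed)
    have "cocone J B (F \<circ>\<^sub>F D) Y \<psi>"
      unfolding cocone_def
    proof (intro conjI ballI FD Y)
      fix x assume "x \<in> Obj J"
      then show "\<psi> x \<in> Hom B (fobj (F \<circ>\<^sub>F D) x) Y"
        using w uv by (cases "x \<in> S") (auto simp: func_comp_def \<psi>_def)
    next
      fix z assume "z \<in> Arr J"
      then show "\<psi> (Cod J z) \<cdot>\<^bsub>B\<^esub> farr (F \<circ>\<^sub>F D) z = \<psi> (Dom J z)"
      proof (rule ArrE)
        fix x assume "z = c (x, x)"
        then show ?thesis
          using uv w[of x u] FI(1)[OF D_obj[of x]]
          by (cases "x \<in> S") (auto simp: func_comp_def \<psi>_def Hom_def)
      next
        fix x y assume "z = c (x, y)" "x \<in> S" "y \<notin> S"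
        then show ?thesis
          using eq by (auto simp: func_comp_def \<psi>_def)
      qed
    qed
    then obtain h where h: "h \<in> Hom B (fobj F X) Y" "\<forall>j\<in>Obj J. h \<cdot>\<^bsub>B\<^esub> farr F (\<phi> j) = \<psi> j"
      using col unfolding is_colimit_def by blast
    have "h \<cdot>\<^bsub>B\<^esub> farr F (\<phi> a) = \<psi> a" "h \<cdot>\<^bsub>B\<^esub> farr F (\<phi> b) = \<psi> b"
      using h(2) by (auto simp: T_def)
    then show "u = v"
      using h(1) ab FI X by (auto simp: \<phi>_def \<psi>_def Hom_def)
  qed
  then show ?thesis
    using Fg FI(2)[OF X] unfolding jointly_epic_def by (auto simp: Hom_def)
qed

text \<open>The previous lemma wants an index set inside \<open>'j\<close> that misses two points.
  Removing two points from an infinite type does not change its cardinality, so \<open>S\<close>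
  embeds into what remains.\<close>

lemma jointly_epic_image:
  fixes S :: "'i set"
  assumes F: "is_functor A B F" and pres: "preserves_colimits TYPE('j) A B F"
    and inf: "infinite (UNIV :: 'j set)" and S: "S \<lesssim> (UNIV :: 'j set)"
    and epi: "jointly_epic A S g X"
  shows "jointly_epic B S (\<lambda>i. farr F (g i)) (fobj F X)"
proof -
  obtain a :: 'j where True by blast
  obtain b :: 'j where "b \<noteq> a"
    using inf by (metis (full_types) finite.emptyI finite_insert insertCI UNIV_eq_I)
  have M: "infinite (UNIV - {a, b})"
    using inf by simp
  have "insert a (insert b (UNIV - {a, b})) \<approx> UNIV - {a, b}"
    using M by (meson eqpoll_trans finite_insert infinite_insert_eqpoll)
  moreover have "insert a (insert b (UNIV - {a, b})) = UNIV" by auto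
  ultimately have "(UNIV :: 'j set) \<approx> UNIV - {a, b}" by simp
  with S have "S \<lesssim> UNIV - {a, b}"
    by (meson eqpoll_imp_lepoll lepoll_trans)
  then obtain e where e: "inj_on e S" "e ` S \<subseteq> UNIV - {a, b}"
    unfolding lepoll_def by blast
  define k where "k = inv_into S e"
  have ke [simp]: "k (e i) = i" if "i \<in> S" for i
    using e(1) that by (simp add: k_def)
  have "jointly_epic A (e ` S) (\<lambda>j. g (k j)) X"
    using epi by (auto simp: jointly_epic_def)
  then have "jointly_epic B (e ` S) (\<lambda>j. farr F (g (k j))) (fobj F X)"
    using e(2) \<open>b \<noteq> a\<close> by (intro jointly_epic_image_aux[OF F pres inf, of _ _ _ a b]) auto
  then show ?thesis by (auto simp: jointly_epic_def)
qed

section \<open>Additive monoidal categories\<close>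

context additive_category
begin

lemma Zero_simps [simp]:
  assumes "X \<in> Obj C" "Y \<in> Obj C"
  shows "Zero C X Y \<in> Arr C" "Dom C (Zero C X Y) = X" "Cod C (Zero C X Y) = Y"
proof -
  interpret G: comm_group "hom_group C X Y" using assms by (rule hom_comm_group)
  have "Zero C X Y \<in> Hom C X Y"
    using G.one_closed by (simp add: hom_group_def)
  then show "Zero C X Y \<in> Arr C" "Dom C (Zero C X Y) = X" "Cod C (Zero C X Y) = Y"
    by (auto simp: Hom_def)
qed

lemma Add_simps [simp]:
  assumes "f \<in> Arr C" "g \<in> Arr C" "Dom C g = Dom C f" "Cod C g = Cod C f"
  shows "f \<boxplus> g \<in> Arr C" "Dom C (f \<boxplus> g) = Dom C f" "Cod C (f \<boxplus> g) = Cod C f"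
proof -
  interpret G: comm_group "hom_group C (Dom C f) (Cod C f)"
    using assms by (intro hom_comm_group) auto
  have "f \<boxplus> g \<in> Hom C (Dom C f) (Cod C f)"
    using G.m_closed[of f g] assms by (simp add: hom_group_def Hom_def)
  then show "f \<boxplus> g \<in> Arr C" "Dom C (f \<boxplus> g) = Dom C f" "Cod C (f \<boxplus> g) = Cod C f"
    by (auto simp: Hom_def)
qed

text \<open>In a group only the neutral element equals its own double. Hence every additive
  operation preserves zero, which is how composites and tensor products with zero are computed
  below.\<close>

lemma idempotent_imp_Zero:
  assumes "f \<in> Hom C X Y" "f \<boxplus> f = f"
  shows "f = Zero C X Y"
proof -
  interpret G: comm_group "hom_group C X Y"
    using assms by (intro hom_comm_group) (auto simp: Hom_def)
  show ?thesis
    using G.r_cancel_one'[of f f] assms by (simp add: hom_group_def)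
qed

lemma Add_Zero:
  assumes "X \<in> Obj C" "Y \<in> Obj C"
  shows "Zero C X Y \<boxplus> Zero C X Y = Zero C X Y"
proof -
  interpret G: comm_group "hom_group C X Y" using assms by (rule hom_comm_group)
  show ?thesis
    using G.r_one[OF G.one_closed] by (simp add: hom_group_def)
qed

lemma Comp_Zero [simp]:
  assumes "g \<in> Arr C" "X \<in> Obj C" "Dom C g = Y"
  shows "g \<cdot> Zero C X Y = Zero C X (Cod C g)"
proof (rule idempotent_imp_Zero)
  show "g \<cdot> Zero C X Y \<in> Hom C X (Cod C g)" using assms by auto
  have "g \<cdot> (Zero C X Y \<boxplus> Zero C X Y) = g \<cdot> Zero C X Y \<boxplus> g \<cdot> Zero C X Y"
    using assms by (intro Comp_add_right[where X = X and Y = Y and Z = "Cod C g"]) auto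
  then show "g \<cdot> Zero C X Y \<boxplus> g \<cdot> Zero C X Y = g \<cdot> Zero C X Y"
    using assms Add_Zero by auto
qed

lemma Zero_Comp [simp]:
  assumes "g \<in> Arr C" "Y \<in> Obj C" "Cod C g = X"
  shows "Zero C X Y \<cdot> g = Zero C (Dom C g) Y"
proof (rule idempotent_imp_Zero)
  show "Zero C X Y \<cdot> g \<in> Hom C (Dom C g) Y" using assms by auto
  have "(Zero C X Y \<boxplus> Zero C X Y) \<cdot> g = Zero C X Y \<cdot> g \<boxplus> Zero C X Y \<cdot> g"
    using assms by (intro Comp_add_left[where Y = X and Z = Y]) auto
  then show "Zero C X Y \<cdot> g \<boxplus> Zero C X Y \<cdot> g = Zero C X Y \<cdot> g"
    using assms Add_Zero by auto
qed

end

section \<open>Coherence of the tensor product\<close>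

context additive_monoidal_category
begin

declare TObj_closed [simp] Unit_closed [simp] TArr_Id [simp]

lemma TArr_simps [simp]:
  assumes "f \<in> Arr C" "g \<in> Arr C"
  shows "f \<otimes>\<^sub>a g \<in> Arr C" "Dom C (f \<otimes>\<^sub>a g) = Dom C f \<otimes>\<^sub>o Dom C g"
    "Cod C (f \<otimes>\<^sub>a g) = Cod C f \<otimes>\<^sub>o Cod C g"
  using TArr_closed[OF Hom_self[OF assms(1)] Hom_self[OF assms(2)]] by (auto simp: Hom_def)

lemma Assoc_simps [simp]:
  assumes "X \<in> Obj C" "Y \<in> Obj C" "Z \<in> Obj C"
  shows "Assoc C X Y Z \<in> Arr C" "Dom C (Assoc C X Y Z) = X \<otimes>\<^sub>o Y \<otimes>\<^sub>o Z"
    "Cod C (Assoc C X Y Z) = X \<otimes>\<^sub>o (Y \<otimes>\<^sub>o Z)" "iso_arr C (Assoc C X Y Z)"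
  using Assoc_closed[OF assms] Assoc_iso[OF assms] by (auto simp: Hom_def)

lemma LUnit_simps [simp]:
  assumes "X \<in> Obj C"
  shows "LUnit C X \<in> Arr C" "Dom C (LUnit C X) = Unit C \<otimes>\<^sub>o X" "Cod C (LUnit C X) = X"
    "iso_arr C (LUnit C X)"
  using LUnit_closed[OF assms] LUnit_iso[OF assms] by (auto simp: Hom_def)

lemma RUnit_simps [simp]:
  assumes "X \<in> Obj C"
  shows "RUnit C X \<in> Arr C" "Dom C (RUnit C X) = X \<otimes>\<^sub>o Unit C" "Cod C (RUnit C X) = X"
    "iso_arr C (RUnit C X)"
  using RUnit_closed[OF assms] RUnit_iso[OF assms] by (auto simp: Hom_def)

lemma interchange:
  "\<lbrakk>f \<in> Arr C; f' \<in> Arr C; g \<in> Arr C; g' \<in> Arr C; Dom C f' = Cod C f; Dom C g' = Cod C g\<rbrakk>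
    \<Longrightarrow> (f' \<otimes>\<^sub>a g') \<cdot> (f \<otimes>\<^sub>a g) = (f' \<cdot> f) \<otimes>\<^sub>a (g' \<cdot> g)"
  by (rule TArr_Comp[symmetric]) (auto intro: HomI)

lemma iso_TArr [simp]:
  assumes "iso_arr C f" "iso_arr C g"
  shows "iso_arr C (f \<otimes>\<^sub>a g)"
  using assms by (intro iso_arrI[where g = "inv_arr C f \<otimes>\<^sub>a inv_arr C g"]) (simp_all add: interchange)

lemma Assoc_naturality:
  "\<lbrakk>f \<in> Arr C; g \<in> Arr C; h \<in> Arr C; Dom C f = X; Dom C g = Y; Dom C h = Z;
    Cod C f = X'; Cod C g = Y'; Cod C h = Z'\<rbrakk>
    \<Longrightarrow> Assoc C X' Y' Z' \<cdot> ((f \<otimes>\<^sub>a g) \<otimes>\<^sub>a h) = (f \<otimes>\<^sub>a (g \<otimes>\<^sub>a h)) \<cdot> Assoc C X Y Z"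
  by (rule Assoc_natural) auto

lemma LUnit_naturality:
  "\<lbrakk>f \<in> Arr C; Dom C f = X; Cod C f = Y\<rbrakk>
    \<Longrightarrow> LUnit C Y \<cdot> (Id C (Unit C) \<otimes>\<^sub>a f) = f \<cdot> LUnit C X"
  by (rule LUnit_natural) auto

lemma TArr_Zero:
  assumes "X \<in> Obj C" "Y \<in> Obj C" "Z \<in> Obj C"
  shows "Id C X \<otimes>\<^sub>a Zero C Y Z = Zero C (X \<otimes>\<^sub>o Y) (X \<otimes>\<^sub>o Z)"
proof (rule idempotent_imp_Zero)
  show "Id C X \<otimes>\<^sub>a Zero C Y Z \<in> Hom C (X \<otimes>\<^sub>o Y) (X \<otimes>\<^sub>o Z)" using assms by auto
  have "Id C X \<otimes>\<^sub>a (Zero C Y Z \<boxplus> Zero C Y Z) = Id C X \<otimes>\<^sub>a Zero C Y Z \<boxplus> Id C X \<otimes>\<^sub>a Zero C Y Z"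
    using assms by (intro TArr_add_right) auto
  then show "Id C X \<otimes>\<^sub>a Zero C Y Z \<boxplus> Id C X \<otimes>\<^sub>a Zero C Y Z = Id C X \<otimes>\<^sub>a Zero C Y Z"
    using assms Add_Zero by auto
qed

text \<open>The unit constraint is natural, so tensoring with \<open>I\<close> on the left is faithful.\<close>

lemma Unit_TArr_cancel:
  assumes "f \<in> Arr C" "g \<in> Arr C" "Dom C g = Dom C f" "Cod C g = Cod C f"
    and "Id C (Unit C) \<otimes>\<^sub>a f = Id C (Unit C) \<otimes>\<^sub>a g"
  shows "f = g"
proof (rule iso_cancel_right)
  show "f \<cdot> LUnit C (Dom C f) = g \<cdot> LUnit C (Dom C f)"
    using LUnit_naturality[of f] LUnit_naturality[of g] assms by simp
qed (use assms in auto)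

text \<open>Kelly's argument: the identity tensored with \<open>I\<close> on the left follows from the pentagon and
  two triangles, and the extra \<open>I\<close> can be cancelled.\<close>

lemma LUnit_Assoc:
  assumes [simp]: "X \<in> Obj C" "Y \<in> Obj C"
  shows "LUnit C (X \<otimes>\<^sub>o Y) \<cdot> Assoc C (Unit C) X Y = LUnit C X \<otimes>\<^sub>a Id C Y"
proof (rule Unit_TArr_cancel)
  let ?I = "Unit C"
  \<comment> \<open>An isomorphism from ((I \<otimes> I) \<otimes> X) \<otimes> Y to I \<otimes> ((I
    \<otimes> X) \<otimes> Y), hence cancellable; composing with it produces the long side of the
    pentagon.\<close>
  let ?p = "Assoc C ?I (?I \<otimes>\<^sub>o X) Y \<cdot> (Assoc C ?I ?I X \<otimes>\<^sub>a Id C Y)"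
  show "Id C ?I \<otimes>\<^sub>a (LUnit C (X \<otimes>\<^sub>o Y) \<cdot> Assoc C ?I X Y) = Id C ?I \<otimes>\<^sub>a (LUnit C X \<otimes>\<^sub>a Id C Y)"
  proof (rule iso_cancel_right)
    have "(Id C ?I \<otimes>\<^sub>a (LUnit C (X \<otimes>\<^sub>o Y) \<cdot> Assoc C ?I X Y)) \<cdot> ?p
        = ((Id C ?I \<otimes>\<^sub>a LUnit C (X \<otimes>\<^sub>o Y)) \<cdot> (Id C ?I \<otimes>\<^sub>a Assoc C ?I X Y)) \<cdot> ?p"
      by (simp add: interchange)
    also have "\<dots> = (Id C ?I \<otimes>\<^sub>a LUnit C (X \<otimes>\<^sub>o Y))
        \<cdot> ((Id C ?I \<otimes>\<^sub>a Assoc C ?I X Y) \<cdot> Assoc C ?I (?I \<otimes>\<^sub>o X) Y \<cdot> (Assoc C ?I ?I X \<otimes>\<^sub>a Id C Y))"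
      by (simp add: Comp_assoc_Arr)
    also have "\<dots> = (Id C ?I \<otimes>\<^sub>a LUnit C (X \<otimes>\<^sub>o Y))
        \<cdot> (Assoc C ?I ?I (X \<otimes>\<^sub>o Y) \<cdot> Assoc C (?I \<otimes>\<^sub>o ?I) X Y)"
      by (subst pentagon) auto
    also have "\<dots> = (Id C ?I \<otimes>\<^sub>a LUnit C (X \<otimes>\<^sub>o Y)) \<cdot> Assoc C ?I ?I (X \<otimes>\<^sub>o Y)
        \<cdot> Assoc C (?I \<otimes>\<^sub>o ?I) X Y"
      by (simp add: Comp_assoc_Arr)
    also have "\<dots> = (RUnit C ?I \<otimes>\<^sub>a (Id C X \<otimes>\<^sub>a Id C Y)) \<cdot> Assoc C (?I \<otimes>\<^sub>o ?I) X Y"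
      by (subst triangle) auto
    also have "\<dots> = Assoc C ?I X Y \<cdot> ((RUnit C ?I \<otimes>\<^sub>a Id C X) \<otimes>\<^sub>a Id C Y)"
      by (rule Assoc_naturality[symmetric]) auto
    \<comment> \<open>The triangle at I and X, tensored with Y and read from right to left.\<close>
    also have "\<dots> = Assoc C ?I X Y \<cdot> (((Id C ?I \<otimes>\<^sub>a LUnit C X) \<otimes>\<^sub>a Id C Y)
        \<cdot> (Assoc C ?I ?I X \<otimes>\<^sub>a Id C Y))"
      by (simp add: interchange triangle)
    also have "\<dots> = Assoc C ?I X Y \<cdot> ((Id C ?I \<otimes>\<^sub>a LUnit C X) \<otimes>\<^sub>a Id C Y)
        \<cdot> (Assoc C ?I ?I X \<otimes>\<^sub>a Id C Y)"
      by (simp add: Comp_assoc_Arr)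
    also have "\<dots> = (Id C ?I \<otimes>\<^sub>a (LUnit C X \<otimes>\<^sub>a Id C Y)) \<cdot> Assoc C ?I (?I \<otimes>\<^sub>o X) Y
        \<cdot> (Assoc C ?I ?I X \<otimes>\<^sub>a Id C Y)"
      by (subst Assoc_naturality) auto
    also have "\<dots> = (Id C ?I \<otimes>\<^sub>a (LUnit C X \<otimes>\<^sub>a Id C Y)) \<cdot> ?p"
      by (simp add: Comp_assoc_Arr)
    finally show "(Id C ?I \<otimes>\<^sub>a (LUnit C (X \<otimes>\<^sub>o Y) \<cdot> Assoc C ?I X Y)) \<cdot> ?p
        = (Id C ?I \<otimes>\<^sub>a (LUnit C X \<otimes>\<^sub>a Id C Y)) \<cdot> ?p" .
  qed auto
qed auto

lemma additive_functor_tensor_right: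
  assumes [simp]: "L \<in> Obj C"
  shows "additive_functor C C (tensor_right C L)"
  unfolding additive_functor_def is_functor_def tensor_right_def
  using category_axioms by (auto simp: interchange intro!: TArr_add_left elim!: HomE)

lemma is_functor_tensor_right: "L \<in> Obj C \<Longrightarrow> is_functor C C (tensor_right C L)"
  using additive_functor_tensor_right by (simp add: additive_functor_def)

end

section \<open>Natural transformations determined at a generator\<close>

lemma is_functor_func_comp:
  "\<lbrakk>is_functor A B F; is_functor B D G\<rbrakk> \<Longrightarrow> is_functor A D (G \<circ>\<^sub>F F)"
  unfolding is_functor_def func_comp_def by simp blast

text \<open>Naturality along f from I to X expresses the component at X, restricted along
  \<open>farr F f\<close>, through the component at I. These restrictions suffice by joint epicness,
  and off the objects both families are \<open>undefined\<close>.\<close>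

lemma nat_trans_eqI:
  assumes \<tau>: "nat_trans A B F G \<tau>" "nat_trans A B F G \<tau>'"
    and gen: "\<And>X. X \<in> Obj A \<Longrightarrow> jointly_epic B (Hom A I X) (farr F) (fobj F X)"
    and I: "I \<in> Obj A" "\<tau> I = \<tau>' I"
  shows "\<tau> = \<tau>'"
proof
  fix X
  show "\<tau> X = \<tau>' X"
  proof (cases "X \<in> Obj A")
    case True
    have "\<tau> X \<cdot>\<^bsub>B\<^esub> farr F f = \<tau>' X \<cdot>\<^bsub>B\<^esub> farr F f" if "f \<in> Hom A I X" for f
      using \<tau> I that True unfolding nat_trans_def by metis
    moreover have "\<tau> X \<in> Hom B (fobj F X) (fobj G X)" "\<tau>' X \<in> Hom B (fobj F X) (fobj G X)"
      using \<tau> True unfolding nat_trans_def by auto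
    ultimately show ?thesis
      using gen[OF True] unfolding jointly_epic_def by blast
  next
    case False
    with \<tau> show ?thesis
      unfolding nat_trans_def extensional_def by auto
  qed
qed

section \<open>The correspondence\<close>

locale monoidal_object = additive_monoidal_category +
  fixes L
  assumes L [simp]: "L \<in> Obj C"
begin

abbreviation "F \<equiv> tensor_right C L"

lemma F_simps:
  "fobj F X = X \<otimes>\<^sub>o L" "farr F f = f \<otimes>\<^sub>a Id C L"
  "fobj (F \<circ>\<^sub>F F) X = X \<otimes>\<^sub>o L \<otimes>\<^sub>o L" "farr (F \<circ>\<^sub>F F) f = f \<otimes>\<^sub>a Id C L \<otimes>\<^sub>a Id C L"
  "is_functor C C F" "is_functor C C (F \<circ>\<^sub>F F)"
  using is_functor_func_comp[of C C F C F] is_functor_tensor_right[of L]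
  by (simp_all, simp_all add: func_comp_def tensor_right_def)

text \<open>Together with \<open>bracket\<close> this will be the inverse of evaluation at I. Both
  are restricted to objects because \<open>nat_trans\<close> demands the value
  \<open>undefined\<close> elsewhere.\<close>

definition braiding :: "'b \<Rightarrow> 'a \<Rightarrow> 'b" where
  "braiding c = (\<lambda>X\<in>Obj C. inv_arr C (Assoc C X L L) \<cdot> ((Id C X \<otimes>\<^sub>a c) \<cdot> Assoc C X L L))"

definition bracket :: "'b \<Rightarrow> 'a \<Rightarrow> 'b" where
  "bracket b = (\<lambda>X\<in>Obj C. (Id C X \<otimes>\<^sub>a b) \<cdot> Assoc C X L L)"

text \<open>This rebracketing ends in X \<otimes> ((L \<otimes> L) \<otimes> L), with the threefold
  power bracketed as in the YB-Lie identities.\<close>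

definition Assoc3 :: "'a \<Rightarrow> 'b" where
  "Assoc3 X = Assoc C X (L \<otimes>\<^sub>o L) L \<cdot> (Assoc C X L L \<otimes>\<^sub>a Id C L)"


lemma Assoc3_simps [simp]:
  assumes "X \<in> Obj C"
  shows "iso_arr C (Assoc3 X)" "Assoc3 X \<in> Arr C" "Dom C (Assoc3 X) = X \<otimes>\<^sub>o L \<otimes>\<^sub>o L \<otimes>\<^sub>o L"
    "Cod C (Assoc3 X) = X \<otimes>\<^sub>o (L \<otimes>\<^sub>o L \<otimes>\<^sub>o L)"
  using assms by (simp_all add: Assoc3_def)

text \<open>The pentagon at X, L, L, L. Rebracketing with X \<otimes> L in place of X differs from
  \<open>Assoc3 X\<close> by an associator of L, the source of the conjugation in
  \<open>YB2\<close>.\<close>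

lemma Assoc_Assoc3:
  assumes [simp]: "X \<in> Obj C"
  shows "Assoc C X L (L \<otimes>\<^sub>o L) \<cdot> Assoc C (X \<otimes>\<^sub>o L) L L = (Id C X \<otimes>\<^sub>a Assoc C L L L) \<cdot> Assoc3 X"
  using pentagon[of X L L L] by (simp add: Assoc3_def Comp_assoc_Arr)

text \<open>\<open>represents X p q s f\<close>: the arrow \<open>s\<close> corresponds to \<open>X \<otimes> f\<close> under the
  identifications \<open>p\<close> and \<open>q\<close> of its source and target with \<open>X \<otimes> \<dots>\<close>.\<close>

definition represents :: "'a \<Rightarrow> 'b \<Rightarrow> 'b \<Rightarrow> 'b \<Rightarrow> 'b \<Rightarrow> bool" where
  "represents X p q s f \<longleftrightarrow> X \<in> Obj C \<and> iso_arr C p \<and> iso_arr C q \<and> s \<in> Hom C (Dom C p) (Dom C q)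
     \<and> f \<in> Arr C \<and> Cod C p = X \<otimes>\<^sub>o Dom C f \<and> Cod C q = X \<otimes>\<^sub>o Cod C f
     \<and> q \<cdot> s = (Id C X \<otimes>\<^sub>a f) \<cdot> p"

text \<open>The middle identification \<open>q\<close> cancels. With the rules for sums, identities
  and zeros this assembles both sides of every axiom from a few basic arrows.\<close>

lemma represents_Comp:
  assumes s: "represents X p q s f" and s': "represents X q r s' f'" and "Dom C f' = Cod C f"
  shows "represents X p r (s' \<cdot> s) (f' \<cdot> f)"
proof -
  have [simp]: "X \<in> Obj C" "iso_arr C p" "iso_arr C q" "iso_arr C r" "s \<in> Arr C" "s' \<in> Arr C"
    "Dom C s = Dom C p" "Cod C s = Dom C q" "Dom C s' = Dom C q" "Cod C s' = Dom C r"
    "f \<in> Arr C" "f' \<in> Arr C" "Dom C f' = Cod C f" "Cod C p = X \<otimes>\<^sub>o Dom C f"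
    "Cod C q = X \<otimes>\<^sub>o Cod C f" "Cod C r = X \<otimes>\<^sub>o Cod C f'"
    and eq: "q \<cdot> s = (Id C X \<otimes>\<^sub>a f) \<cdot> p" "r \<cdot> s' = (Id C X \<otimes>\<^sub>a f') \<cdot> q"
    using assms by (auto simp: represents_def Hom_def)
  have "r \<cdot> (s' \<cdot> s) = (r \<cdot> s') \<cdot> s"
    by (simp add: Comp_assoc_Arr)
  also have "\<dots> = (Id C X \<otimes>\<^sub>a f') \<cdot> (q \<cdot> s)"
    by (simp add: eq(2) Comp_assoc_Arr)
  also have "\<dots> = ((Id C X \<otimes>\<^sub>a f') \<cdot> (Id C X \<otimes>\<^sub>a f)) \<cdot> p"
    by (simp add: eq(1) Comp_assoc_Arr)
  also have "\<dots> = (Id C X \<otimes>\<^sub>a (f' \<cdot> f)) \<cdot> p"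
    by (simp add: interchange)
  finally show ?thesis
    by (auto simp: represents_def)
qed

lemma represents_Add:
  assumes s: "represents X p q s f" "represents X p q s' f'"
    and "Dom C f' = Dom C f" "Cod C f' = Cod C f"
  shows "represents X p q (s \<boxplus> s') (f \<boxplus> f')"
proof -
  have [simp]: "X \<in> Obj C" "iso_arr C p" "iso_arr C q" "s \<in> Arr C" "s' \<in> Arr C"
    "Dom C s = Dom C p" "Cod C s = Dom C q" "Dom C s' = Dom C p" "Cod C s' = Dom C q"
    "f \<in> Arr C" "f' \<in> Arr C" "Dom C f' = Dom C f" "Cod C f' = Cod C f"
    "Cod C p = X \<otimes>\<^sub>o Dom C f" "Cod C q = X \<otimes>\<^sub>o Cod C f"
    and eq: "q \<cdot> s = (Id C X \<otimes>\<^sub>a f) \<cdot> p" "q \<cdot> s' = (Id C X \<otimes>\<^sub>a f') \<cdot> p"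
    using assms by (auto simp: represents_def Hom_def)
  have "q \<cdot> (s \<boxplus> s') = q \<cdot> s \<boxplus> q \<cdot> s'"
    by (rule Comp_add_right) auto
  also have "\<dots> = ((Id C X \<otimes>\<^sub>a f) \<boxplus> (Id C X \<otimes>\<^sub>a f')) \<cdot> p"
    unfolding eq by (rule Comp_add_left[symmetric]) auto
  also have "\<dots> = (Id C X \<otimes>\<^sub>a (f \<boxplus> f')) \<cdot> p"
    by (subst TArr_add_right) auto
  finally show ?thesis
    by (auto simp: represents_def)
qed

lemma represents_Id:
  assumes "X \<in> Obj C" "P \<in> Obj C" "iso_arr C p" "Cod C p = X \<otimes>\<^sub>o P" "Dom C p = Q"
  shows "represents X p p (Id C Q) (Id C P)"
  using assms by (auto simp: represents_def)

lemma represents_Zero: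
  assumes "X \<in> Obj C" "P \<in> Obj C" "Q \<in> Obj C" "iso_arr C p" "iso_arr C q"
    "Cod C p = X \<otimes>\<^sub>o P" "Cod C q = X \<otimes>\<^sub>o Q" "Dom C p = P'" "Dom C q = Q'"
  shows "represents X p q (Zero C P' Q') (Zero C P Q)"
  using assms by (auto simp: represents_def TArr_Zero)

lemma represents_eq_iff:
  assumes s: "represents X p q s f" "represents X p q s' f'"
  shows "s = s' \<longleftrightarrow> Id C X \<otimes>\<^sub>a f = Id C X \<otimes>\<^sub>a f'"
proof
  assume "s = s'"
  with s show "Id C X \<otimes>\<^sub>a f = Id C X \<otimes>\<^sub>a f'"
    by - (rule iso_cancel_right[of p], auto simp: represents_def)
next
  assume "Id C X \<otimes>\<^sub>a f = Id C X \<otimes>\<^sub>a f'"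
  with s show "s = s'"
    by - (rule iso_cancel_left[of q], auto simp: represents_def Hom_def)
qed

text \<open>From left to right the single case X = I is enough, since I \<otimes> - is faithful.
  From right to left, equal representing arrows give equal arrows at each X.\<close>

lemma represents_all_eq_iff:
  assumes s: "\<And>X. X \<in> Obj C \<Longrightarrow> represents X (p X) (q X) (s X) f"
    "\<And>X. X \<in> Obj C \<Longrightarrow> represents X (p X) (q X) (s' X) f'"
    and f: "Dom C f' = Dom C f" "Cod C f' = Cod C f"
  shows "(\<forall>X\<in>Obj C. s X = s' X) \<longleftrightarrow> f = f'"
proof
  assume "\<forall>X\<in>Obj C. s X = s' X"
  then have "Id C (Unit C) \<otimes>\<^sub>a f = Id C (Unit C) \<otimes>\<^sub>a f'"
    using represents_eq_iff[OF s[OF Unit_closed]] by simp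
  moreover have "f \<in> Arr C" "f' \<in> Arr C"
    using s[OF Unit_closed] by (auto simp: represents_def)
  ultimately show "f = f'" using f Unit_TArr_cancel by blast
next
  assume "f = f'"
  then show "\<forall>X\<in>Obj C. s X = s' X"
    using represents_eq_iff[OF s] by simp
qed

lemma YB_simps [simp]:
  assumes [simp]: "c \<in> Arr C" "Dom C c = L \<otimes>\<^sub>o L" "Cod C c = L \<otimes>\<^sub>o L"
  shows "YB1 C L c \<in> Arr C" "Dom C (YB1 C L c) = L \<otimes>\<^sub>o L \<otimes>\<^sub>o L"
    "Cod C (YB1 C L c) = L \<otimes>\<^sub>o L \<otimes>\<^sub>o L"
    "YB2 C L c \<in> Arr C" "Dom C (YB2 C L c) = L \<otimes>\<^sub>o L \<otimes>\<^sub>o L"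
    "Cod C (YB2 C L c) = L \<otimes>\<^sub>o L \<otimes>\<^sub>o L"
  by (simp_all add: YB1_def YB2_def)

context
  fixes c
  assumes c [simp]: "c \<in> Arr C" "Dom C c = L \<otimes>\<^sub>o L" "Cod C c = L \<otimes>\<^sub>o L"
begin

lemma represents_braiding:
  assumes [simp]: "X \<in> Obj C"
  shows "represents X (Assoc C X L L) (Assoc C X L L) (braiding c X) c"
  by (auto simp: represents_def braiding_def)

text \<open>This is the functor - \<otimes> L applied to the component at X: c acts on the first two
  copies of L, and naturality of the associator carries X outside.\<close>

lemma represents_braiding_TArr:
  assumes [simp]: "X \<in> Obj C"
  shows "represents X (Assoc3 X) (Assoc3 X) (braiding c X \<otimes>\<^sub>a Id C L) (YB1 C L c)"
proof -
  let ?a = "Assoc C X L L" and ?a' = "Assoc C X (L \<otimes>\<^sub>o L) L"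
  have [simp]: "braiding c X \<in> Arr C" "Dom C (braiding c X) = X \<otimes>\<^sub>o L \<otimes>\<^sub>o L"
    "Cod C (braiding c X) = X \<otimes>\<^sub>o L \<otimes>\<^sub>o L" and eq: "?a \<cdot> braiding c X = (Id C X \<otimes>\<^sub>a c) \<cdot> ?a"
    using represents_braiding[of X] by (auto simp: represents_def Hom_def)
  have "Assoc3 X \<cdot> (braiding c X \<otimes>\<^sub>a Id C L) = ?a' \<cdot> ((?a \<cdot> braiding c X) \<otimes>\<^sub>a Id C L)"
    by (simp add: Assoc3_def Comp_assoc_Arr interchange)
  also have "\<dots> = ?a' \<cdot> ((Id C X \<otimes>\<^sub>a c) \<otimes>\<^sub>a Id C L) \<cdot> (?a \<otimes>\<^sub>a Id C L)"
    by (simp add: eq Comp_assoc_Arr interchange)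
  also have "\<dots> = (Id C X \<otimes>\<^sub>a YB1 C L c) \<cdot> ?a' \<cdot> (?a \<otimes>\<^sub>a Id C L)"
    unfolding YB1_def by (subst Assoc_naturality) auto
  also have "\<dots> = (Id C X \<otimes>\<^sub>a YB1 C L c) \<cdot> Assoc3 X"
    by (simp add: Assoc3_def Comp_assoc_Arr)
  finally show ?thesis
    by (auto simp: represents_def)
qed

text \<open>In the component at X \<otimes> L one copy of L is absorbed into the object, so c acts
  on the last two copies. With the preceding lemma, \<open>t_nat\<close> corresponds to
  \<open>t_op\<close> and \<open>w_nat\<close> to \<open>w_op\<close>.\<close>

lemma represents_braiding_shift:
  assumes [simp]: "X \<in> Obj C"
  shows "represents X (Assoc3 X) (Assoc3 X) (braiding c (X \<otimes>\<^sub>o L)) (YB2 C L c)"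
proof -
  let ?A = "Id C X \<otimes>\<^sub>a Assoc C L L L" and ?s = "braiding c (X \<otimes>\<^sub>o L)"
  let ?a = "Assoc C X L (L \<otimes>\<^sub>o L)" and ?a' = "Assoc C (X \<otimes>\<^sub>o L) L L"
  have [simp]: "?s \<in> Arr C" "Dom C ?s = X \<otimes>\<^sub>o L \<otimes>\<^sub>o L \<otimes>\<^sub>o L" "Cod C ?s = X \<otimes>\<^sub>o L \<otimes>\<^sub>o L \<otimes>\<^sub>o L"
    and eq: "?a' \<cdot> ?s = (Id C (X \<otimes>\<^sub>o L) \<otimes>\<^sub>a c) \<cdot> ?a'"
    using represents_braiding[of "X \<otimes>\<^sub>o L"] by (auto simp: represents_def Hom_def)
  have YB2: "Assoc C L L L \<cdot> YB2 C L c = (Id C L \<otimes>\<^sub>a c) \<cdot> Assoc C L L L"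
    by (simp add: YB2_def Comp_assoc_Arr)
  \<comment> \<open>Composing with the invertible \<open>?A\<close> makes the pentagon applicable;
    \<open>?A\<close> is cancelled at the end.\<close>
  have "?A \<cdot> (Assoc3 X \<cdot> ?s) = (?A \<cdot> Assoc3 X) \<cdot> ?s"
    by (simp add: Comp_assoc_Arr)
  also have "\<dots> = ?a \<cdot> (?a' \<cdot> ?s)"
    by (simp add: Assoc_Assoc3[symmetric] Comp_assoc_Arr)
  also have "\<dots> = ?a \<cdot> ((Id C X \<otimes>\<^sub>a Id C L) \<otimes>\<^sub>a c) \<cdot> ?a'"
    by (simp add: eq Comp_assoc_Arr)
  also have "\<dots> = (Id C X \<otimes>\<^sub>a (Id C L \<otimes>\<^sub>a c)) \<cdot> ?a \<cdot> ?a'"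
    by (subst Assoc_naturality) auto
  also have "\<dots> = (Id C X \<otimes>\<^sub>a (Id C L \<otimes>\<^sub>a c)) \<cdot> (?A \<cdot> Assoc3 X)"
    by (simp add: Comp_assoc_Arr Assoc_Assoc3)
  also have "\<dots> = ((Id C X \<otimes>\<^sub>a (Id C L \<otimes>\<^sub>a c)) \<cdot> ?A) \<cdot> Assoc3 X"
    by (simp add: Comp_assoc_Arr)
  also have "\<dots> = (?A \<cdot> (Id C X \<otimes>\<^sub>a YB2 C L c)) \<cdot> Assoc3 X"
    by (simp add: interchange YB2)
  also have "\<dots> = ?A \<cdot> ((Id C X \<otimes>\<^sub>a YB2 C L c) \<cdot> Assoc3 X)"
    by (simp add: Comp_assoc_Arr)
  finally have "Assoc3 X \<cdot> ?s = (Id C X \<otimes>\<^sub>a YB2 C L c) \<cdot> Assoc3 X"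
    by - (rule iso_cancel_left[of ?A], auto)
  then show ?thesis
    by (auto simp: represents_def)
qed

text \<open>The arrow f acts on the first tensor factor and c on the others, so they commute by
  interchange; the associators pass by naturality.\<close>

lemma nat_trans_braiding: "nat_trans C C (F \<circ>\<^sub>F F) (F \<circ>\<^sub>F F) (braiding c)"
  unfolding nat_trans_def
proof (intro conjI ballI)
  fix X Y f assume "X \<in> Obj C" "Y \<in> Obj C" and "f \<in> Hom C X Y"
  then have [simp]: "f \<in> Arr C" "Dom C f = X" "Cod C f = Y" "X \<in> Obj C" "Y \<in> Obj C"
    by (auto simp: Hom_def)
  let ?f = "f \<otimes>\<^sub>a Id C L \<otimes>\<^sub>a Id C L"
  have "braiding c Y \<cdot> ?f
      = inv_arr C (Assoc C Y L L) \<cdot> ((Id C Y \<otimes>\<^sub>a c) \<cdot> (Assoc C Y L L \<cdot> ?f))"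
    by (simp add: braiding_def Comp_assoc_Arr)
  also have "\<dots> = inv_arr C (Assoc C Y L L)
      \<cdot> ((Id C Y \<otimes>\<^sub>a c) \<cdot> ((f \<otimes>\<^sub>a (Id C L \<otimes>\<^sub>a Id C L)) \<cdot> Assoc C X L L))"
    by (subst Assoc_naturality) auto
  also have "\<dots> = inv_arr C (Assoc C Y L L)
      \<cdot> (((Id C Y \<otimes>\<^sub>a c) \<cdot> (f \<otimes>\<^sub>a (Id C L \<otimes>\<^sub>a Id C L))) \<cdot> Assoc C X L L)"
    by (simp add: Comp_assoc_Arr)
  also have "\<dots> = inv_arr C (Assoc C Y L L)
      \<cdot> (((f \<otimes>\<^sub>a (Id C L \<otimes>\<^sub>a Id C L)) \<cdot> (Id C X \<otimes>\<^sub>a c)) \<cdot> Assoc C X L L)"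
    by (simp add: interchange)
  also have "\<dots> = inv_arr C (Assoc C Y L L) \<cdot> ((f \<otimes>\<^sub>a (Id C L \<otimes>\<^sub>a Id C L)) \<cdot> Assoc C X L L) \<cdot> braiding c X"
    by (simp add: braiding_def Comp_assoc_Arr)
  also have "\<dots> = inv_arr C (Assoc C Y L L) \<cdot> (Assoc C Y L L \<cdot> ?f) \<cdot> braiding c X"
    by (subst Assoc_naturality) auto
  also have "\<dots> = ?f \<cdot> braiding c X"
    by simp
  finally show "braiding c Y \<cdot> farr (F \<circ>\<^sub>F F) f = farr (F \<circ>\<^sub>F F) f \<cdot> braiding c X"
    by (simp add: F_simps)
qed (auto simp: braiding_def F_simps)

end

section \<open>The transformation - \<otimes> b\<close>

context
  fixes b
  assumes b [simp]: "b \<in> Arr C" "Dom C b = L \<otimes>\<^sub>o L" "Cod C b = L"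
begin

text \<open>The target X \<otimes> L needs no rebracketing, so an identity serves on that
  side.\<close>

lemma represents_bracket:
  assumes [simp]: "X \<in> Obj C"
  shows "represents X (Assoc C X L L) (Id C (X \<otimes>\<^sub>o L)) (bracket b X) b"
  by (auto simp: represents_def bracket_def)

lemma represents_bracket_TArr:
  assumes [simp]: "X \<in> Obj C"
  shows "represents X (Assoc3 X) (Assoc C X L L) (bracket b X \<otimes>\<^sub>a Id C L) (b \<otimes>\<^sub>a Id C L)"
proof -
  let ?a = "Assoc C X L L" and ?a' = "Assoc C X (L \<otimes>\<^sub>o L) L"
  have "?a \<cdot> (bracket b X \<otimes>\<^sub>a Id C L) = ?a \<cdot> ((Id C X \<otimes>\<^sub>a b) \<otimes>\<^sub>a Id C L) \<cdot> (?a \<otimes>\<^sub>a Id C L)"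
    by (simp add: bracket_def Comp_assoc_Arr interchange)
  also have "\<dots> = (Id C X \<otimes>\<^sub>a (b \<otimes>\<^sub>a Id C L)) \<cdot> ?a' \<cdot> (?a \<otimes>\<^sub>a Id C L)"
    by (subst Assoc_naturality) auto
  also have "\<dots> = (Id C X \<otimes>\<^sub>a (b \<otimes>\<^sub>a Id C L)) \<cdot> Assoc3 X"
    by (simp add: Assoc3_def Comp_assoc_Arr)
  finally show ?thesis
    by (auto simp: represents_def bracket_def)
qed

lemma represents_bracket_shift:
  assumes [simp]: "X \<in> Obj C"
  shows "represents X (Assoc3 X) (Assoc C X L L) (bracket b (X \<otimes>\<^sub>o L))
    ((Id C L \<otimes>\<^sub>a b) \<cdot> Assoc C L L L)"
proof -
  have "Assoc C X L L \<cdot> bracket b (X \<otimes>\<^sub>o L)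
      = Assoc C X L L \<cdot> ((Id C X \<otimes>\<^sub>a Id C L) \<otimes>\<^sub>a b) \<cdot> Assoc C (X \<otimes>\<^sub>o L) L L"
    by (simp add: bracket_def Comp_assoc_Arr)
  also have "\<dots> = (Id C X \<otimes>\<^sub>a (Id C L \<otimes>\<^sub>a b)) \<cdot> Assoc C X L (L \<otimes>\<^sub>o L) \<cdot> Assoc C (X \<otimes>\<^sub>o L) L L"
    by (subst Assoc_naturality) auto
  also have "\<dots> = (Id C X \<otimes>\<^sub>a (Id C L \<otimes>\<^sub>a b)) \<cdot> ((Id C X \<otimes>\<^sub>a Assoc C L L L) \<cdot> Assoc3 X)"
    by (simp add: Comp_assoc_Arr Assoc_Assoc3)
  also have "\<dots> = ((Id C X \<otimes>\<^sub>a (Id C L \<otimes>\<^sub>a b)) \<cdot> (Id C X \<otimes>\<^sub>a Assoc C L L L)) \<cdot> Assoc3 X"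
    by (simp add: Comp_assoc_Arr)
  also have "\<dots> = (Id C X \<otimes>\<^sub>a ((Id C L \<otimes>\<^sub>a b) \<cdot> Assoc C L L L)) \<cdot> Assoc3 X"
    by (simp add: interchange)
  finally show ?thesis
    by (auto simp: represents_def bracket_def)
qed

lemma nat_trans_bracket: "nat_trans C C (F \<circ>\<^sub>F F) F (bracket b)"
  unfolding nat_trans_def
proof (intro conjI ballI)
  fix X Y f assume "X \<in> Obj C" "Y \<in> Obj C" and "f \<in> Hom C X Y"
  then have [simp]: "f \<in> Arr C" "Dom C f = X" "Cod C f = Y" "X \<in> Obj C" "Y \<in> Obj C"
    by (auto simp: Hom_def)
  let ?f = "f \<otimes>\<^sub>a Id C L \<otimes>\<^sub>a Id C L"
  have "bracket b Y \<cdot> ?f = (Id C Y \<otimes>\<^sub>a b) \<cdot> (Assoc C Y L L \<cdot> ?f)"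
    by (simp add: bracket_def Comp_assoc_Arr)
  also have "\<dots> = (Id C Y \<otimes>\<^sub>a b) \<cdot> ((f \<otimes>\<^sub>a (Id C L \<otimes>\<^sub>a Id C L)) \<cdot> Assoc C X L L)"
    by (subst Assoc_naturality) auto
  also have "\<dots> = ((Id C Y \<otimes>\<^sub>a b) \<cdot> (f \<otimes>\<^sub>a (Id C L \<otimes>\<^sub>a Id C L))) \<cdot> Assoc C X L L"
    by (simp add: Comp_assoc_Arr)
  also have "\<dots> = ((f \<otimes>\<^sub>a Id C L) \<cdot> (Id C X \<otimes>\<^sub>a b)) \<cdot> Assoc C X L L"
    by (simp add: interchange)
  also have "\<dots> = (f \<otimes>\<^sub>a Id C L) \<cdot> bracket b X"
    by (simp add: bracket_def Comp_assoc_Arr)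
  finally show "bracket b Y \<cdot> farr (F \<circ>\<^sub>F F) f = farr F f \<cdot> bracket b X"
    by (simp add: F_simps)
qed (auto simp: bracket_def F_simps)

end

text \<open>Additivity of the functor and naturality hold for all such c and b, so only the five
  equations are at stake. Each is an equation between represented arrows, and
  \<open>represents_all_eq_iff\<close> trades it at all X for one equation between the representing
  arrows.\<close>

lemma Lie_monad_iff_YB_Lie_algebra:
  assumes c: "c \<in> Hom C (L \<otimes>\<^sub>o L) (L \<otimes>\<^sub>o L)" and b: "b \<in> Hom C (L \<otimes>\<^sub>o L) L"
  shows "Lie_monad C F (braiding c) (bracket b) \<longleftrightarrow> YB_Lie_algebra C L c b"
proof -
  note c' [simp] = HomD[OF c] and b' [simp] = HomD[OF b]
  \<comment> \<open>Applied repeatedly, these rules follow the structure of a composite; the middle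
    identification left open by \<open>represents_Comp\<close> is fixed by its inner factor.\<close>
  note reps = represents_braiding[OF c'] represents_bracket[OF b'] represents_braiding_TArr[OF c']
    represents_bracket_TArr[OF b'] represents_braiding_shift[OF c'] represents_bracket_shift[OF b']
    represents_Comp represents_Add represents_Id represents_Zero
  have 1: "(\<forall>X\<in>Obj C. braiding c X \<cdot> braiding c X = Id C (X \<otimes>\<^sub>o L \<otimes>\<^sub>o L))
      \<longleftrightarrow> c \<cdot> c = Id C (L \<otimes>\<^sub>o L)"
    by (rule represents_all_eq_iff[where p = "\<lambda>X. Assoc C X L L" and q = "\<lambda>X. Assoc C X L L"];
        (rule reps | simp)+)
  have 2: "(\<forall>X\<in>Obj C. (braiding c X \<otimes>\<^sub>a Id C L) \<cdot> braiding c (X \<otimes>\<^sub>o L) \<cdot> (braiding c X \<otimes>\<^sub>a Id C L)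
        = braiding c (X \<otimes>\<^sub>o L) \<cdot> (braiding c X \<otimes>\<^sub>a Id C L) \<cdot> braiding c (X \<otimes>\<^sub>o L))
      \<longleftrightarrow> YB1 C L c \<cdot> YB2 C L c \<cdot> YB1 C L c = YB2 C L c \<cdot> YB1 C L c \<cdot> YB2 C L c"
    by (rule represents_all_eq_iff[where p = Assoc3 and q = Assoc3]; (rule reps | simp)+)
  have 3: "(\<forall>X\<in>Obj C. bracket b X \<cdot> (Id C (X \<otimes>\<^sub>o L \<otimes>\<^sub>o L) \<boxplus> braiding c X)
        = Zero C (X \<otimes>\<^sub>o L \<otimes>\<^sub>o L) (X \<otimes>\<^sub>o L))
      \<longleftrightarrow> b \<cdot> (Id C (L \<otimes>\<^sub>o L) \<boxplus> c) = Zero C (L \<otimes>\<^sub>o L) L"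
    by (rule represents_all_eq_iff[where p = "\<lambda>X. Assoc C X L L" and q = "\<lambda>X. Id C (X \<otimes>\<^sub>o L)"];
        (rule reps | simp)+)
  have 4: "(\<forall>X\<in>Obj C. bracket b X \<cdot> bracket b (X \<otimes>\<^sub>o L)
          \<cdot> (Id C (X \<otimes>\<^sub>o L \<otimes>\<^sub>o L \<otimes>\<^sub>o L) \<boxplus> (braiding c X \<otimes>\<^sub>a Id C L) \<cdot> braiding c (X \<otimes>\<^sub>o L)
            \<boxplus> braiding c (X \<otimes>\<^sub>o L) \<cdot> (braiding c X \<otimes>\<^sub>a Id C L))
        = Zero C (X \<otimes>\<^sub>o L \<otimes>\<^sub>o L \<otimes>\<^sub>o L) (X \<otimes>\<^sub>o L))
      \<longleftrightarrow> b \<cdot> ((Id C L \<otimes>\<^sub>a b) \<cdot> Assoc C L L L)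
          \<cdot> (Id C (L \<otimes>\<^sub>o L \<otimes>\<^sub>o L) \<boxplus> YB1 C L c \<cdot> YB2 C L c \<boxplus> YB2 C L c \<cdot> YB1 C L c)
        = Zero C (L \<otimes>\<^sub>o L \<otimes>\<^sub>o L) L"
    by (rule represents_all_eq_iff[where p = Assoc3 and q = "\<lambda>X. Id C (X \<otimes>\<^sub>o L)"];
        (rule reps | simp)+)
  have 5: "(\<forall>X\<in>Obj C. braiding c X \<cdot> (bracket b X \<otimes>\<^sub>a Id C L)
        = bracket b (X \<otimes>\<^sub>o L) \<cdot> ((braiding c X \<otimes>\<^sub>a Id C L) \<cdot> braiding c (X \<otimes>\<^sub>o L)))
      \<longleftrightarrow> c \<cdot> (b \<otimes>\<^sub>a Id C L) = ((Id C L \<otimes>\<^sub>a b) \<cdot> Assoc C L L L) \<cdot> (YB1 C L c \<cdot> YB2 C L c)"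
    by (rule represents_all_eq_iff[where p = Assoc3 and q = "\<lambda>X. Assoc C X L L"];
        (rule reps | simp)+)
  \<comment> \<open>The shifted bracket is represented by the composite in parentheses, whereas the
    Jacobi identity in \<open>YB_Lie_algebra\<close> associates to the left.\<close>
  have assoc: "b \<cdot> ((Id C L \<otimes>\<^sub>a b) \<cdot> Assoc C L L L) = b \<cdot> (Id C L \<otimes>\<^sub>a b) \<cdot> Assoc C L L L"
    by (simp add: Comp_assoc_Arr)
  show ?thesis
    unfolding Lie_monad_def YB_Lie_algebra_def symmetric_YB_operator_def Let_def ball_conj_distrib
      t_nat_def w_nat_def t_op_def w_op_def
    using nat_trans_braiding[OF c'] nat_trans_bracket[OF b'] additive_category_axioms
      additive_functor_tensor_right[OF L] b c 1 2 3 4 5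
    by (simp add: F_simps assoc)
qed

section \<open>Evaluation at the unit object\<close>

lemma braiding_at_unit_closed:
  assumes "nat_trans C C (F \<circ>\<^sub>F F) (F \<circ>\<^sub>F F) \<sigma>"
  shows "braiding_at_unit C L \<sigma> \<in> Hom C (L \<otimes>\<^sub>o L) (L \<otimes>\<^sub>o L)"
proof -
  have "\<sigma> (Unit C) \<in> Hom C (Unit C \<otimes>\<^sub>o L \<otimes>\<^sub>o L) (Unit C \<otimes>\<^sub>o L \<otimes>\<^sub>o L)"
    using assms by (simp add: nat_trans_def F_simps)
  then show ?thesis
    by (auto simp: braiding_at_unit_def Let_def Hom_def)
qed

lemma bracket_at_unit_closed:
  assumes "nat_trans C C (F \<circ>\<^sub>F F) F \<Lambda>"
  shows "bracket_at_unit C L \<Lambda> \<in> Hom C (L \<otimes>\<^sub>o L) L"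
proof -
  have "\<Lambda> (Unit C) \<in> Hom C (Unit C \<otimes>\<^sub>o L \<otimes>\<^sub>o L) (Unit C \<otimes>\<^sub>o L)"
    using assms by (simp add: nat_trans_def F_simps)
  then show ?thesis
    by (auto simp: bracket_at_unit_def Let_def Hom_def)
qed

text \<open>By \<open>LUnit_Assoc\<close> the arrow on the left is the unit constraint of L
  \<otimes> L after an associator; naturality of that constraint then moves c across.\<close>

lemma LUnit_braiding_Unit:
  assumes c: "c \<in> Hom C (L \<otimes>\<^sub>o L) (L \<otimes>\<^sub>o L)"
  shows "(LUnit C L \<otimes>\<^sub>a Id C L) \<cdot> braiding c (Unit C) = c \<cdot> (LUnit C L \<otimes>\<^sub>a Id C L)"
proof -
  have [simp]: "c \<in> Arr C" "Dom C c = L \<otimes>\<^sub>o L" "Cod C c = L \<otimes>\<^sub>o L"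
    using c by (auto simp: Hom_def)
  let ?a = "Assoc C (Unit C) L L"
  have "(LUnit C L \<otimes>\<^sub>a Id C L) \<cdot> braiding c (Unit C)
      = (LUnit C (L \<otimes>\<^sub>o L) \<cdot> (Id C (Unit C) \<otimes>\<^sub>a c)) \<cdot> ?a"
    by (simp add: braiding_def LUnit_Assoc[symmetric] Comp_assoc_Arr)
  also have "\<dots> = c \<cdot> (LUnit C (L \<otimes>\<^sub>o L) \<cdot> ?a)"
    by (simp add: LUnit_naturality Comp_assoc_Arr)
  finally show ?thesis
    by (simp add: LUnit_Assoc)
qed

lemma LUnit_bracket_Unit:
  assumes b: "b \<in> Hom C (L \<otimes>\<^sub>o L) L"
  shows "LUnit C L \<cdot> bracket b (Unit C) = b \<cdot> (LUnit C L \<otimes>\<^sub>a Id C L)"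
proof -
  have [simp]: "b \<in> Arr C" "Dom C b = L \<otimes>\<^sub>o L" "Cod C b = L"
    using b by (auto simp: Hom_def)
  let ?a = "Assoc C (Unit C) L L"
  have "LUnit C L \<cdot> bracket b (Unit C) = (LUnit C L \<cdot> (Id C (Unit C) \<otimes>\<^sub>a b)) \<cdot> ?a"
    by (simp add: bracket_def Comp_assoc_Arr)
  also have "\<dots> = b \<cdot> (LUnit C (L \<otimes>\<^sub>o L) \<cdot> ?a)"
    by (simp add: LUnit_naturality Comp_assoc_Arr)
  finally show ?thesis
    by (simp add: LUnit_Assoc)
qed

lemma braiding_at_unit_braiding:
  assumes c: "c \<in> Hom C (L \<otimes>\<^sub>o L) (L \<otimes>\<^sub>o L)"
  shows "braiding_at_unit C L (braiding c) = c"
  using c unfolding braiding_at_unit_def Let_def LUnit_braiding_Unit[OF c]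
  by (auto simp: Comp_assoc_Arr Hom_def)

lemma bracket_at_unit_bracket:
  assumes b: "b \<in> Hom C (L \<otimes>\<^sub>o L) L"
  shows "bracket_at_unit C L (bracket b) = b"
  using b unfolding bracket_at_unit_def Let_def LUnit_bracket_Unit[OF b]
  by (auto simp: Comp_assoc_Arr Hom_def)

text \<open>Both transformations have the same component at I, because conjugation by the unit
  constraint is undone there. Joint epicness for the common source functor extends this to every
  object.\<close>

lemma braiding_braiding_at_unit:
  assumes gen: "\<And>X. X \<in> Obj C \<Longrightarrow>
      jointly_epic C (Hom C (Unit C) X) (farr (F \<circ>\<^sub>F F)) (fobj (F \<circ>\<^sub>F F) X)"
    and \<sigma>: "nat_trans C C (F \<circ>\<^sub>F F) (F \<circ>\<^sub>F F) \<sigma>"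
  shows "braiding (braiding_at_unit C L \<sigma>) = \<sigma>"
proof -
  let ?u = "LUnit C L \<otimes>\<^sub>a Id C L" and ?c = "braiding_at_unit C L \<sigma>"
  have c: "?c \<in> Hom C (L \<otimes>\<^sub>o L) (L \<otimes>\<^sub>o L)"
    using \<sigma> by (rule braiding_at_unit_closed)
  have [simp]: "\<sigma> (Unit C) \<in> Arr C" "Dom C (\<sigma> (Unit C)) = Unit C \<otimes>\<^sub>o L \<otimes>\<^sub>o L"
    "Cod C (\<sigma> (Unit C)) = Unit C \<otimes>\<^sub>o L \<otimes>\<^sub>o L"
    using \<sigma> by (auto simp: nat_trans_def F_simps Hom_def)
  have "?u \<cdot> braiding ?c (Unit C) = ?c \<cdot> ?u"
    using c by (rule LUnit_braiding_Unit)
  also have "\<dots> = ?u \<cdot> \<sigma> (Unit C)"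
    by (simp add: braiding_at_unit_def Let_def Comp_assoc_Arr)
  finally have "braiding ?c (Unit C) = \<sigma> (Unit C)"
    using represents_braiding[OF HomD[OF c], of "Unit C"]
    by - (rule iso_cancel_left[of ?u], auto simp: represents_def Hom_def)
  then show ?thesis
    using nat_trans_eqI[OF nat_trans_braiding[OF HomD[OF c]] \<sigma> gen Unit_closed] by simp
qed

lemma bracket_bracket_at_unit:
  assumes gen: "\<And>X. X \<in> Obj C \<Longrightarrow>
      jointly_epic C (Hom C (Unit C) X) (farr (F \<circ>\<^sub>F F)) (fobj (F \<circ>\<^sub>F F) X)"
    and \<Lambda>: "nat_trans C C (F \<circ>\<^sub>F F) F \<Lambda>"
  shows "bracket (bracket_at_unit C L \<Lambda>) = \<Lambda>"
proof -
  let ?u = "LUnit C L \<otimes>\<^sub>a Id C L" and ?b = "bracket_at_unit C L \<Lambda>"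
  have b: "?b \<in> Hom C (L \<otimes>\<^sub>o L) L"
    using \<Lambda> by (rule bracket_at_unit_closed)
  have [simp]: "\<Lambda> (Unit C) \<in> Arr C" "Dom C (\<Lambda> (Unit C)) = Unit C \<otimes>\<^sub>o L \<otimes>\<^sub>o L"
    "Cod C (\<Lambda> (Unit C)) = Unit C \<otimes>\<^sub>o L"
    using \<Lambda> by (auto simp: nat_trans_def F_simps Hom_def)
  have "LUnit C L \<cdot> bracket ?b (Unit C) = ?b \<cdot> ?u"
    using b by (rule LUnit_bracket_Unit)
  also have "\<dots> = LUnit C L \<cdot> \<Lambda> (Unit C)"
    by (simp add: bracket_at_unit_def Let_def Comp_assoc_Arr)
  finally have "bracket ?b (Unit C) = \<Lambda> (Unit C)"
    using represents_bracket[OF HomD[OF b], of "Unit C"]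
    by - (rule iso_cancel_left[of "LUnit C L"], auto simp: represents_def Hom_def)
  then show ?thesis
    using nat_trans_eqI[OF nat_trans_bracket[OF HomD[OF b]] \<Lambda> gen Unit_closed] by simp
qed

end

theorem proposition4p5:
  fixes C :: "('o, 'a, 'm) mon_cat_scheme" and L :: 'o
  assumes "additive_monoidal_category C"
    and "infinite (UNIV :: 'j set)"
    and "locally_small TYPE('j) C"
    and "regular_generator C (Unit C)"
    and "\<And>X. X \<in> Obj C \<Longrightarrow> preserves_colimits TYPE('j) C C (tensor_right C X)"
    and "\<And>X. X \<in> Obj C \<Longrightarrow> preserves_colimits TYPE('j) C C (tensor_left C X)"
    and "L \<in> Obj C"
  shows "(\<forall>\<sigma> \<Lambda>. Lie_monad C (tensor_right C L) \<sigma> \<Lambda> \<longrightarrow>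
            YB_Lie_algebra C L (braiding_at_unit C L \<sigma>) (bracket_at_unit C L \<Lambda>))
       \<and> bij_betw (\<lambda>(\<sigma>, \<Lambda>). (braiding_at_unit C L \<sigma>, bracket_at_unit C L \<Lambda>))
           {(\<sigma>, \<Lambda>). Lie_monad C (tensor_right C L) \<sigma> \<Lambda>}
           {(c, b). YB_Lie_algebra C L c b}"
proof -
  interpret monoidal_object C L
    using assms(1,7) by (intro monoidal_object.intro monoidal_object_axioms.intro)
  \<comment> \<open>The arrows from I to X are jointly epic, and - \<otimes> L is applied to this
    family twice.\<close>
  have gen: "jointly_epic C (Hom C (Unit C) X) (farr (F \<circ>\<^sub>F F)) (fobj (F \<circ>\<^sub>F F) X)"
    if X: "X \<in> Obj C" for X
  proof -
    have small: "Hom C (Unit C) X \<lesssim> (UNIV :: 'j set)"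
      using assms(3) X by (simp add: locally_small_def)
    note image = jointly_epic_image[OF is_functor_tensor_right[OF L] assms(5)[OF L] assms(2) small]
    show ?thesis
      using image[OF image[OF regular_generator_jointly_epic[OF assms(4) X]]]
      by (simp add: func_comp_def)
  qed
  have closed: "braiding_at_unit C L \<sigma> \<in> Hom C (L \<otimes>\<^sub>o\<^bsub>C\<^esub> L) (L \<otimes>\<^sub>o\<^bsub>C\<^esub> L)"
      "bracket_at_unit C L \<Lambda> \<in> Hom C (L \<otimes>\<^sub>o\<^bsub>C\<^esub> L) L"
    and inv: "braiding (braiding_at_unit C L \<sigma>) = \<sigma>" "bracket (bracket_at_unit C L \<Lambda>) = \<Lambda>"
    if "Lie_monad C F \<sigma> \<Lambda>" for \<sigma> \<Lambda>
    using that gen by (auto simp: Lie_monad_def intro!: braiding_at_unit_closed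
        bracket_at_unit_closed braiding_braiding_at_unit bracket_bracket_at_unit)
  \<comment> \<open>Since \<sigma> and \<Lambda> are recovered from their values at I, the
    equivalence for \<open>braiding\<close> and \<open>bracket\<close> covers every Lie monad
    structure.\<close>
  have lie: "YB_Lie_algebra C L (braiding_at_unit C L \<sigma>) (bracket_at_unit C L \<Lambda>)"
    if "Lie_monad C F \<sigma> \<Lambda>" for \<sigma> \<Lambda>
    using Lie_monad_iff_YB_Lie_algebra[OF closed[OF that]] inv[OF that] that by simp
  have from_YB: "Lie_monad C F (braiding c) (bracket b)" "braiding_at_unit C L (braiding c) = c"
      "bracket_at_unit C L (bracket b) = b" if "YB_Lie_algebra C L c b" for c b
  proof -
    have cb: "c \<in> Hom C (L \<otimes>\<^sub>o\<^bsub>C\<^esub> L) (L \<otimes>\<^sub>o\<^bsub>C\<^esub> L)" "b \<in> Hom C (L \<otimes>\<^sub>o\<^bsub>C\<^esub> L) L"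
      using that by (auto simp: YB_Lie_algebra_def symmetric_YB_operator_def)
    show "Lie_monad C F (braiding c) (bracket b)"
      using Lie_monad_iff_YB_Lie_algebra[OF cb] that by simp
    show "braiding_at_unit C L (braiding c) = c" "bracket_at_unit C L (bracket b) = b"
      using cb by (simp_all add: braiding_at_unit_braiding bracket_at_unit_bracket)
  qed
  have "bij_betw (\<lambda>(\<sigma>, \<Lambda>). (braiding_at_unit C L \<sigma>, bracket_at_unit C L \<Lambda>))
      {(\<sigma>, \<Lambda>). Lie_monad C F \<sigma> \<Lambda>} {(c, b). YB_Lie_algebra C L c b}"
    by (rule bij_betw_byWitness[where f' = "\<lambda>(c, b). (braiding c, bracket b)"])
      (auto simp: inv lie from_YB)
  with lie show ?thesis by blast
qed

end
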